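(* Let $\mathcal{D}\subset\mathbb{H}$ be open, bounded and connected. If $q_0\in\partial\mathcal{D}$ satisfies the exterior $\mathbb{H}$-corkscrew condition, then $q_0$ is walk-regular.
   Context: $\mathbb{H}=(\mathbb{R}^3,* )$ is the first Heisenberg group with $(x,y,z)*(x',y',z')=(x+x',y+y',z+z'+\frac12(xy'-yx'))$. The Korányi gauge is $|(x,y,z)|_K=((x^2+y^2)^2+16z^2)^{1/4}$, the metric is $d(q,q')=|q^{-1}*q'|_K$, $d(q,\partial\mathcal{D})$ is the distance to $\partial\mathcal{D}$ in this metric, and $B_r(q)=\{q'\in\mathbb{H}: d(q,q')<r\}$. Exterior $\mathbb{H}$-corkscrew condition at $q_0\in\partial\mathcal{D}$: there exists $\mu\in(0,1)$ such that for all sufficiently small $r>0$ there exists a ball $B_{\mu r}(p_0)$ with $B_{\mu r}(p_0)\subset B_r(q_0)\setminus\mathcal{D}$. Horizontal $\epsilon$-walk: let $w_1,w_2,\ldots$ be independent random variables, uniformly distributed on the Euclidean unit disc $B_1^2(0)\subset\mathbb{R}^2$ (on the countable product probability space $(\Omega,\mathcal{F},\mathbb{P})$ of the disc with normalized Lebesgue measure). For $q_0\in\mathcal{D}$ and $\epsilon\in(0,1)$ set $Q_0^{\epsilon,q_0}=q_0$ and, writing $w_n=(a_n,b_n)$ and $\lambda_{n-1}=\min\{\epsilon,d(Q^{\epsilon,q_0}_{n-1},\partial\mathcal{D})\}$, $$Q_n^{\epsilon,q_0}=Q_{n-1}^{\epsilon,q_0}*(\lambda_{n-1}a_n,\lambda_{n-1}b_n,0).$$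 This sequence is a bounded martingale with values in $\mathcal{D}$, converging almost surely to a random variable $Q^{\epsilon,q_0}$ with values in $\partial\mathcal{D}$. A point $q_0\in\partial\mathcal{D}$ is walk-regular if for every $\eta,\delta>0$ there exist $\hat\delta\in(0,\delta)$ and $\hat\epsilon\in(0,1)$ such that $\mathbb{P}(Q^{\epsilon,q}\in B_\delta(q_0))\ge1-\eta$ for all $\epsilon\in(0,\hat\epsilon)$ and all $q\in B_{\hat\delta}(q_0)\cap\mathcal{D}$. *)

theory Defs
  imports "HOL-Probability.Probability"
begin

text \<open>
  The Heisenberg group is carried by \<open>real \<times> real \<times> real\<close>. Open, bounded and connected sets,
  boundaries (\<^const>\<open>frontier\<close>) and limits are those of this type, i.e. Euclidean; the
  Koranyi metric induces the same topology and has the same bounded sets.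
\<close>

type_synonym heis = "real \<times> real \<times> real"

fun heis_mult :: "heis \<Rightarrow> heis \<Rightarrow> heis" (infixl \<open>\<star>\<close> 70) where
  "(x, y, z) \<star> (x', y', z') = (x + x', y + y', z + z' + (x * y' - y * x') / 2)"

fun heis_inv :: "heis \<Rightarrow> heis" where
  "heis_inv (x, y, z) = (- x, - y, - z)"

fun koranyi_gauge :: "heis \<Rightarrow> real" where
  "koranyi_gauge (x, y, z) = root 4 ((x\<^sup>2 + y\<^sup>2)\<^sup>2 + 16 * z\<^sup>2)"

definition heis_dist :: "heis \<Rightarrow> heis \<Rightarrow> real" where
  "heis_dist q q' = koranyi_gauge (heis_inv q \<star> q')"

definition heis_ball :: "heis \<Rightarrow> real \<Rightarrow> heis set" where
  "heis_ball q r = {q'. heis_dist q q' < r}"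

definition heis_setdist :: "heis \<Rightarrow> heis set \<Rightarrow> real" where
  "heis_setdist q S = (INF p\<in>S. heis_dist q p)"

definition exterior_corkscrew :: "heis set \<Rightarrow> heis \<Rightarrow> bool" where
  "exterior_corkscrew D q\<^sub>0 \<longleftrightarrow>
     (\<exists>\<mu>. 0 < \<mu> \<and> \<mu> < 1 \<and>
        (\<forall>\<^sub>F r in at_right 0. \<exists>p\<^sub>0. heis_ball p\<^sub>0 (\<mu> * r) \<subseteq> heis_ball q\<^sub>0 r - D))"

text \<open>The norm of \<open>real \<times> real\<close> is the Euclidean one, so the ball below is the round unit disc.\<close>

definition disc :: "(real \<times> real) set" where
  "disc = ball 0 1"

definition disc_measure :: "(real \<times> real) measure" where
  "disc_measure = uniform_measure (restrict_space lborel disc) disc"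

definition walk_space :: "(nat \<Rightarrow> real \<times> real) measure" where
  "walk_space = (\<Pi>\<^sub>M n\<in>UNIV. disc_measure)"

text \<open>Coordinates are numbered from \<open>0\<close>: the \<open>n\<close>-th step \<open>w\<^sub>n\<close> (\<open>n \<ge> 1\<close>) is \<open>\<omega> (n - 1)\<close>.\<close>

primrec heis_walk ::
  "heis set \<Rightarrow> real \<Rightarrow> heis \<Rightarrow> (nat \<Rightarrow> real \<times> real) \<Rightarrow> nat \<Rightarrow> heis" where
  "heis_walk D \<epsilon> q \<omega> 0 = q"
| "heis_walk D \<epsilon> q \<omega> (Suc n) =
     (let Q = heis_walk D \<epsilon> q \<omega> n;
          l = min \<epsilon> (heis_setdist Q (frontier D));
          (a, b) = \<omega> n
      in Q \<star> (l * a, l * b, 0))"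

text \<open>
  Where the walk does not converge (a null event for bounded open \<open>D\<close> and \<open>q \<in> D\<close>),
  \<^const>\<open>lim\<close> returns a fixed unspecified point.
\<close>

definition walk_limit ::
  "heis set \<Rightarrow> real \<Rightarrow> heis \<Rightarrow> (nat \<Rightarrow> real \<times> real) \<Rightarrow> heis" where
  "walk_limit D \<epsilon> q \<omega> = lim (\<lambda>n. heis_walk D \<epsilon> q \<omega> n)"

definition walk_regular :: "heis set \<Rightarrow> heis \<Rightarrow> bool" where
  "walk_regular D q\<^sub>0 \<longleftrightarrow>
     (\<forall>\<eta>>0. \<forall>\<delta>>0. \<exists>\<delta>' \<epsilon>'. 0 < \<delta>' \<and> \<delta>' < \<delta> \<and> 0 < \<epsilon>' \<and> \<epsilon>' < 1 \<and>
        (\<forall>\<epsilon> q. 0 < \<epsilon> \<and> \<epsilon> < \<epsilon>' \<and> q \<in> heis_ball q\<^sub>0 \<delta>' \<inter> D \<longrightarrow>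
           \<P>(\<omega> in walk_space. walk_limit D \<epsilon> q \<omega> \<in> heis_ball q\<^sub>0 \<delta>) \<ge> 1 - \<eta>))"

end

theory Submission
  imports Defs
begin

text \<open>
  Let \<open>T f q\<close> be the expectation of \<open>f\<close> after one step of the walk from \<open>q\<close>. If \<open>W \<ge> 0\<close> satisfies
  \<open>T W \<le> W\<close> on \<open>D\<close>, then the walk from \<open>q\<close> ever meets \<open>{W \<ge> 1}\<close> with probability at most \<open>W q\<close>.
  Applied to \<open>|q - q\<^sub>*|\<^sup>2\<close> plus the expected remaining quadratic variation, this shows that the walk is
  almost surely Cauchy. For the boundary behaviour, a corkscrew ball at scale \<open>r\<close> with centre \<open>p\<close> gives
  a supersolution \<open>\<Lambda> - d(p, q)\<^sup>-\<^sup>2 - \<kappa> (x\<^sup>2 + y\<^sup>2)\<close>: the power \<open>-2\<close> of the gauge is harmonic for the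
  sub-Laplacian, so its mean changes only to third order in the step, which the \<open>\<kappa>\<close> term
  dominates. Normalised, it is at least \<open>1\<close> at distance \<open>5 r\<close> from \<open>q\<^sub>0\<close> and at most a \<open>\<theta> < 1\<close>
  independent of \<open>r\<close> at distance \<open>r\<close>. Gluing such functions over \<open>k\<close> decreasing scales yields one
  that is at most \<open>\<theta>\<^sup>k\<close> near \<open>q\<^sub>0\<close> and at least \<open>1\<close> away from \<open>q\<^sub>0\<close>.
\<close>

subsection \<open>Moments of the uniform distribution on the disc\<close>

lemma sets_disc_measure: "sets disc_measure = sets (restrict_space borel disc)"
  by (simp add: disc_measure_def sets_restrict_space)

lemma space_disc_measure: "space disc_measure = disc"
  by (simp add: disc_measure_def space_restrict_space)

lemma disc_sets [measurable]: "disc \<in> sets borel"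
  by (simp add: disc_def)

lemma emeasure_lborel_open_nonzero:
  fixes S :: "'a::euclidean_space set"
  assumes "open S" "S \<noteq> {}"
  shows "emeasure lborel S \<noteq> 0"
proof -
  have "\<not> negligible S" using assms by (rule open_not_negligible)
  moreover have "S \<in> sets lebesgue" using assms by auto
  ultimately have "emeasure lebesgue S \<noteq> 0" by (simp add: negligible_iff_emeasure0)
  then show ?thesis using assms by simp
qed

lemma prob_space_disc_measure: "prob_space disc_measure"
proof -
  have "emeasure lborel disc \<noteq> 0"
    unfolding disc_def by (intro emeasure_lborel_open_nonzero) auto
  moreover have "emeasure lborel disc \<noteq> \<infinity>"
    unfolding disc_def using emeasure_lborel_ball_finite[of "0 :: real \<times> real" 1] by auto
  ultimately show ?thesis
    unfolding disc_measure_def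
    by (intro prob_space_uniform_measure) (simp_all add: emeasure_restrict_space)
qed

interpretation disc: prob_space disc_measure
  by (rule prob_space_disc_measure)

lemma measurable_disc_measure: "f \<in> borel_measurable borel \<Longrightarrow> f \<in> borel_measurable disc_measure"
  by (subst measurable_cong_sets[OF sets_disc_measure refl]) (rule measurable_restrict_space1)

lemma emeasure_disc_measure:
  assumes "B \<in> sets borel" "B \<subseteq> disc"
  shows "emeasure disc_measure B = emeasure lborel B / emeasure lborel disc"
proof -
  have B: "disc \<inter> B = B" using assms by auto
  have "B \<in> sets (restrict_space lborel disc)" "disc \<in> sets (restrict_space lborel disc)"
    using assms by (auto simp: sets_restrict_space)
  then show ?thesis
    using assms unfolding disc_measure_def
    by (simp add: emeasure_restrict_space B)
qed

text \<open>A symmetry of Lebesgue measure under which the disc is its own preimage also preserves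
  the uniform distribution. The moments below come from such symmetries instead of explicit
  integration.\<close>

lemma integral_disc_measure_invariant:
  fixes f :: "real \<times> real \<Rightarrow> real"
  assumes T [measurable]: "T \<in> borel_measurable borel" and inv: "distr lborel borel T = lborel"
    and disc: "T -` disc = disc" and f [measurable]: "f \<in> borel_measurable borel"
  shows "(\<integral>w. f (T w) \<partial>disc_measure) = (\<integral>w. f w \<partial>disc_measure)"
proof -
  have m [measurable]: "T \<in> measurable disc_measure borel" "id \<in> measurable disc_measure borel"
    by (auto intro: measurable_disc_measure simp: id_def)
  \<comment> \<open>Pushing forward along \<open>id\<close> replaces the restricted sigma-algebra by
    \<open>borel\<close>, so that both sides are measures on the same space.\<close>
  have "distr disc_measure borel T = distr disc_measure borel id"
  proof (rule measure_eqI)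
    fix B assume "B \<in> sets (distr disc_measure borel T)"
    then have B [measurable]: "B \<in> sets borel" by simp
    have e: "T -` B \<inter> disc = T -` (B \<inter> disc)" by (simp only: vimage_Int disc)
    have s: "T -` B \<inter> disc \<in> sets borel"
      using measurable_sets[OF T, of "B \<inter> disc"] B by (simp only: e) simp
    have "emeasure disc_measure (T -` B \<inter> disc) = emeasure disc_measure (B \<inter> disc)"
    proof -
      have "emeasure lborel (T -` B \<inter> disc) = emeasure (distr lborel borel T) (B \<inter> disc)"
        unfolding e by (subst emeasure_distr) auto
      then show ?thesis
        unfolding inv using s B by (simp add: emeasure_disc_measure)
    qed
    then show "emeasure (distr disc_measure borel T) B = emeasure (distr disc_measure borel id) B"
      using B m by (simp only: emeasure_distr space_disc_measure vimage_id id_apply)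
  qed simp
  then have "(\<integral>w. f w \<partial>distr disc_measure borel T) = (\<integral>w. f w \<partial>distr disc_measure borel id)"
    by simp
  then show ?thesis
    by (simp only: integral_distr[OF m(1) f] integral_distr[OF m(2) f] id_apply)
qed

lemma disc_norm: "w \<in> disc \<Longrightarrow> norm w < 1"
  by (simp add: disc_def)

lemma disc_bounds:
  assumes "w \<in> disc"
  shows "\<bar>fst w\<bar> \<le> 1" "\<bar>snd w\<bar> \<le> 1"
proof -
  have "\<bar>fst w\<bar> \<le> norm w" "\<bar>snd w\<bar> \<le> norm w"
    using norm_fst_le[of "fst w" "snd w"] norm_snd_le[of "snd w" "fst w"] by simp_all
  with disc_norm[OF assms] show "\<bar>fst w\<bar> \<le> 1" "\<bar>snd w\<bar> \<le> 1" by linarith+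
qed

lemma integrable_disc_measure:
  fixes f :: "real \<times> real \<Rightarrow> real"
  assumes f: "f \<in> borel_measurable borel" and C: "\<And>w. w \<in> disc \<Longrightarrow> \<bar>f w\<bar> \<le> C"
  shows "integrable disc_measure f"
proof (rule disc.integrable_const_bound)
  show "AE w in disc_measure. norm (f w) \<le> C"
    by (rule AE_I2) (simp only: space_disc_measure real_norm_def C)
  show "f \<in> borel_measurable disc_measure"
    using f by (rule measurable_disc_measure)
qed

text \<open>The common second moment of both coordinates. It enters the argument through its
  positivity, not through its value.\<close>

definition disc_moment :: real where
  "disc_moment = (\<integral>w. (fst w)\<^sup>2 \<partial>disc_measure)"

lemma disc_swap: "prod.swap -` disc = disc"
  by (auto simp: disc_def norm_Pair add.commute)

lemma distr_lborel_swap: "distr lborel borel prod.swap = (lborel :: (real \<times> real) measure)"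
proof -
  have "distr lborel borel prod.swap
      = distr (lborel \<Otimes>\<^sub>M lborel) (lborel \<Otimes>\<^sub>M lborel) (\<lambda>(x, y). (y, x) :: real \<times> real)"
    unfolding lborel_prod by (intro distr_cong) auto
  also have "\<dots> = lborel \<Otimes>\<^sub>M lborel"
    by (rule lborel_pair.distr_pair_swap[symmetric])
  finally show ?thesis by (simp add: lborel_prod)
qed

lemma distr_lborel_reflect:
  "distr lborel borel (\<lambda>w. (- fst w, snd w)) = (lborel :: (real \<times> real) measure)"
proof -
  have id: "distr lborel borel (\<lambda>x. x) = (lborel :: real measure)"
    by (rule distr_id2) simp
  have "(lborel :: (real \<times> real) measure)
      = distr lborel borel uminus \<Otimes>\<^sub>M distr lborel borel (\<lambda>x. x)"
    by (simp only: lborel_distr_uminus id lborel_prod)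
  also have "\<dots> = distr (lborel \<Otimes>\<^sub>M lborel) (borel \<Otimes>\<^sub>M borel) (\<lambda>(x, y). (- x, y))"
    by (rule pair_measure_distr) (auto simp: id lborel.sigma_finite_measure_axioms)
  also have "\<dots> = distr lborel borel (\<lambda>w. (- fst w, snd w))"
    unfolding lborel_prod borel_prod by (intro distr_cong) auto
  finally show ?thesis by simp
qed

lemma borel_measurable_fst_snd [measurable]:
  "fst \<in> borel_measurable (borel :: (real \<times> real) measure)"
  "snd \<in> borel_measurable (borel :: (real \<times> real) measure)"
  by (intro borel_measurable_continuous_onI continuous_on_fst continuous_on_snd continuous_on_id)+

text \<open>Reflecting the first coordinate annihilates the moments that are odd in it; swapping the
  coordinates transfers the results to the second one.\<close>

lemma disc_moments:
  shows "(\<integral>w. fst w \<partial>disc_measure) = 0" "(\<integral>w. snd w \<partial>disc_measure) = 0"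
    "(\<integral>w. fst w * snd w \<partial>disc_measure) = 0"
    "(\<integral>w. (snd w)\<^sup>2 \<partial>disc_measure) = disc_moment"
proof -
  have swap: "(\<integral>w. f (prod.swap w) \<partial>disc_measure) = (\<integral>w. f w \<partial>disc_measure)"
    if "f \<in> borel_measurable borel" for f :: "real \<times> real \<Rightarrow> real"
    by (rule integral_disc_measure_invariant[OF borel_measurable_continuous_onI[OF continuous_on_swap]
          distr_lborel_swap disc_swap that])
  have refl: "(\<integral>w. f (- fst w, snd w) \<partial>disc_measure) = (\<integral>w. f w \<partial>disc_measure)"
    if "f \<in> borel_measurable borel" for f :: "real \<times> real \<Rightarrow> real"
    by (intro integral_disc_measure_invariant[where T = "\<lambda>w. (- fst w, snd w)"] distr_lborel_reflect
        that
        borel_measurable_continuous_onI continuous_on_Pair continuous_on_minus continuous_on_fst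
        continuous_on_snd continuous_on_id) (auto simp: disc_def norm_Pair)
  show 1: "(\<integral>w. fst w \<partial>disc_measure) = 0" using refl[of fst] by simp
  show "(\<integral>w. snd w \<partial>disc_measure) = 0" using swap[of snd] 1 by simp
  show "(\<integral>w. fst w * snd w \<partial>disc_measure) = 0" using refl[of "\<lambda>w. fst w * snd w"] by simp
  show "(\<integral>w. (snd w)\<^sup>2 \<partial>disc_measure) = disc_moment"
    using swap[of "\<lambda>w. (snd w)\<^sup>2"] by (simp add: disc_moment_def)
qed

text \<open>A vanishing second moment would make the first coordinate zero almost everywhere, but
  the points of the disc where it is nonzero form a nonempty open set, which has positive
  measure.\<close>

lemma disc_moment_pos: "disc_moment > 0"
proof -
  have int: "integrable disc_measure (\<lambda>w. (fst w)\<^sup>2)"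
    by (rule integrable_disc_measure[where C = 1], measurable) (simp add: disc_bounds abs_square_le_1)
  have "disc_moment \<noteq> 0"
  proof
    assume "disc_moment = 0"
    then have "AE w in disc_measure. (fst w)\<^sup>2 = 0"
      using integral_nonneg_eq_0_iff_AE[OF int] by (simp add: disc_moment_def)
    then have "AE w in disc_measure. fst w = 0" by simp
    define B where "B = disc \<inter> {w. fst w \<noteq> 0}"
    have o: "open B" unfolding B_def disc_def
      by (intro open_Int open_ball open_Collect_neq continuous_intros)
    have "(1/2, 0) \<in> B" by (simp add: B_def disc_def norm_Pair)
    then have "emeasure lborel B \<noteq> 0"
      using emeasure_lborel_open_nonzero[OF o] by auto
    moreover have "emeasure disc_measure B = 0"
    proof -
      have "{w \<in> space disc_measure. \<not> fst w = 0} = B"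
        by (auto simp: B_def space_disc_measure)
      moreover have "{w \<in> space disc_measure. \<not> fst w = 0} \<in> sets disc_measure"
        using measurable_sets[OF measurable_disc_measure[OF borel_measurable_fst_snd(1)], of "- {0}"]
        by (simp add: vimage_def Int_def conj_commute)
      ultimately show ?thesis
        using AE_iff_measurable[of B disc_measure "\<lambda>w. fst w = 0"] \<open>AE w in disc_measure. fst w = 0\<close> by simp
    qed
    moreover have "B \<in> sets borel" "B \<subseteq> disc" using o by (auto simp: B_def)
    moreover have "emeasure lborel disc \<noteq> top"
      unfolding disc_def using emeasure_lborel_ball_finite[of "0 :: real \<times> real" 1] by auto
    ultimately show False
      using emeasure_disc_measure[of B] by (simp add: ennreal_divide_eq_0_iff)
  qed
  moreover have "disc_moment \<ge> 0" by (simp add: disc_moment_def)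
  ultimately show ?thesis by simp
qed

text \<open>One-step means are estimated through integrands that are quadratic in the step; of these
  only the constant and the trace of the quadratic part survive.\<close>

lemma disc_quadratic:
  fixes k0 k1 k2 k3 k4 k5 :: real
  defines "f \<equiv> \<lambda>w. k0 + k1 * fst w + k2 * snd w + k3 * (fst w)\<^sup>2 + k4 * (fst w * snd w) + k5 * (snd w)\<^sup>2"
  shows "integrable disc_measure f" "(\<integral>w. f w \<partial>disc_measure) = k0 + (k3 + k5) * disc_moment"
proof -
  have b: "\<bar>fst w * snd w\<bar> \<le> 1" "\<bar>(fst w)\<^sup>2\<bar> \<le> 1" "\<bar>(snd w)\<^sup>2\<bar> \<le> 1" if "w \<in> disc" for w
    using mult_mono[OF disc_bounds[OF that]] disc_bounds[OF that]
    by (simp_all add: abs_mult abs_square_le_1)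
  have i: "integrable disc_measure fst" "integrable disc_measure snd"
    "integrable disc_measure (\<lambda>w. (fst w)\<^sup>2)" "integrable disc_measure (\<lambda>w. fst w * snd w)"
    "integrable disc_measure (\<lambda>w. (snd w)\<^sup>2)"
    by (rule integrable_disc_measure[where C = 1], measurable, rule b disc_bounds, assumption)+
  have c: "has_bochner_integral disc_measure (\<lambda>w. k0) k0"
    using disc.prob_space by (simp add: has_bochner_integral_iff)
  have h: "has_bochner_integral disc_measure fst 0" "has_bochner_integral disc_measure snd 0"
    "has_bochner_integral disc_measure (\<lambda>w. (fst w)\<^sup>2) disc_moment"
    "has_bochner_integral disc_measure (\<lambda>w. fst w * snd w) 0"
    "has_bochner_integral disc_measure (\<lambda>w. (snd w)\<^sup>2) disc_moment"
    using i disc_moments by (auto simp: has_bochner_integral_iff disc_moment_def)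
  have "has_bochner_integral disc_measure f
      (k0 + k1 * 0 + k2 * 0 + k3 * disc_moment + k4 * 0 + k5 * disc_moment)"
    unfolding f_def
    by (intro has_bochner_integral_add has_bochner_integral_mult_right c h)
  then have "has_bochner_integral disc_measure f (k0 + (k3 + k5) * disc_moment)"
    by (simp add: distrib_right add.assoc)
  then show "integrable disc_measure f" "(\<integral>w. f w \<partial>disc_measure) = k0 + (k3 + k5) * disc_moment"
    unfolding has_bochner_integral_iff by blast+
qed

subsection \<open>The Koranyi metric and steps of the walk\<close>

lemma koranyi_gauge_nonneg [simp]: "koranyi_gauge q \<ge> 0"
  by (cases q) simp

text \<open>Writing the squared gauge as a complex modulus reduces the triangle inequality to the
  one for moduli.\<close>

lemma koranyi_gauge_power2:
  "(koranyi_gauge (x, y, z))\<^sup>2 = cmod (Complex (x\<^sup>2 + y\<^sup>2) (4 * z))"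
proof (rule power2_eq_imp_eq)
  have "root 4 ((x\<^sup>2 + y\<^sup>2)\<^sup>2 + 16 * z\<^sup>2) ^ 4 = (x\<^sup>2 + y\<^sup>2)\<^sup>2 + 16 * z\<^sup>2"
    by (rule real_root_pow_pos2) auto
  then show "((koranyi_gauge (x, y, z))\<^sup>2)\<^sup>2 = (cmod (Complex (x\<^sup>2 + y\<^sup>2) (4 * z)))\<^sup>2"
    by (simp add: cmod_power2 power_mult_distrib flip: power_mult)
qed simp_all

lemma koranyi_gauge_power4: "koranyi_gauge (x, y, z) ^ 4 = (x\<^sup>2 + y\<^sup>2)\<^sup>2 + 16 * z\<^sup>2"
  using koranyi_gauge_power2[of x y z] arg_cong[OF koranyi_gauge_power2[of x y z], of "\<lambda>t. t\<^sup>2"]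
  by (simp add: cmod_power2 power_mult_distrib flip: power_mult)

lemma koranyi_gauge_horizontal: "koranyi_gauge (x, y, 0) = norm (x, y)"
proof -
  have "(koranyi_gauge (x, y, 0))\<^sup>2 = (norm (x, y))\<^sup>2"
    using koranyi_gauge_power2[of x y 0] by (simp add: complex_norm norm_Pair)
  then show ?thesis by (simp add: power2_eq_iff_nonneg)
qed

text \<open>Cygan's argument: in the identity \<open>A + A' + 2 (x - i y) (x' + i y')\<close> for the complex
  number \<open>|z|\<^sup>2 + 4 i t\<close> of a product, the last term has modulus at most \<open>2 N N'\<close>.\<close>
lemma koranyi_gauge_triangle: "koranyi_gauge (p \<star> q) \<le> koranyi_gauge p + koranyi_gauge q"
proof -
  obtain x y z where p: "p = (x, y, z)" by (cases p)
  obtain x' y' z' where q: "q = (x', y', z')" by (cases q)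
  define N N' where "N = koranyi_gauge p" and "N' = koranyi_gauge q"
  \<comment> \<open>The squared horizontal length is the real part of the complex number whose
    modulus is the squared gauge.\<close>
  have hor: "cmod (Complex u v) \<le> koranyi_gauge (u, v, t)" for u v t
  proof (rule power2_le_imp_le)
    have "(cmod (Complex u v))\<^sup>2 = Re (Complex (u\<^sup>2 + v\<^sup>2) (4 * t))"
      by (simp add: cmod_power2)
    also have "\<dots> \<le> cmod (Complex (u\<^sup>2 + v\<^sup>2) (4 * t))" by (rule complex_Re_le_cmod)
    finally show "(cmod (Complex u v))\<^sup>2 \<le> (koranyi_gauge (u, v, t))\<^sup>2"
      by (simp only: koranyi_gauge_power2)
  qed (rule koranyi_gauge_nonneg)
  have "(koranyi_gauge (p \<star> q))\<^sup>2
      = cmod (Complex (x\<^sup>2 + y\<^sup>2) (4 * z) + Complex (x'\<^sup>2 + y'\<^sup>2) (4 * z')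
          + 2 * (Complex x (- y) * Complex x' y'))"
    unfolding p q heis_mult.simps koranyi_gauge_power2
    by (rule arg_cong[where f = cmod])
       (simp add: complex_eq_iff, simp add: power2_eq_square algebra_simps)
  also have "\<dots> \<le> N\<^sup>2 + N'\<^sup>2 + 2 * (cmod (Complex x (- y)) * cmod (Complex x' y'))"
    by (intro order.trans[OF norm_triangle_ineq] add_mono)
       (simp_all add: N_def N'_def p q koranyi_gauge_power2 norm_triangle_ineq norm_mult
         del: koranyi_gauge.simps)
  also have "\<dots> \<le> N\<^sup>2 + N'\<^sup>2 + 2 * (N * N')"
    using hor[of x y z] hor[of x' y' z']
    by (intro add_left_mono mult_left_mono mult_mono)
       (simp_all add: N_def N'_def p q complex_norm del: koranyi_gauge.simps)
  also have "\<dots> = (N + N')\<^sup>2" by (simp add: power2_sum)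
  finally show ?thesis unfolding N_def N'_def by (rule power2_le_imp_le) simp
qed

lemma heis_dist_nonneg [simp]: "heis_dist p q \<ge> 0"
  by (simp add: heis_dist_def)

lemma heis_dist_self [simp]: "heis_dist p p = 0"
  by (cases p) (simp add: heis_dist_def)

lemma heis_dist_commute: "heis_dist p q = heis_dist q p"
proof -
  have "heis_inv q \<star> p = heis_inv (heis_inv p \<star> q)"
    by (cases p; cases q) (simp add: field_simps)
  moreover have "koranyi_gauge (heis_inv u) = koranyi_gauge u" for u
    by (cases u) simp
  ultimately show ?thesis by (simp add: heis_dist_def)
qed

lemma heis_dist_triangle: "heis_dist p r \<le> heis_dist p q + heis_dist q r"
proof -
  have "heis_inv p \<star> r = (heis_inv p \<star> q) \<star> (heis_inv q \<star> r)"
    by (cases p; cases q; cases r) (simp add: field_simps)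
  then show ?thesis unfolding heis_dist_def using koranyi_gauge_triangle by metis
qed

lemma heis_dist_mult_horizontal: "heis_dist q (q \<star> (a, b, 0)) = norm (a, b)"
  by (cases q) (simp add: heis_dist_def koranyi_gauge_horizontal[symmetric] field_simps)

text \<open>The defining equations match only explicit triples. These projection forms let the
  continuity rules apply to arbitrary arguments.\<close>

lemma heis_mult_eq:
  "p \<star> q = (fst p + fst q, fst (snd p) + fst (snd q),
     snd (snd p) + snd (snd q) + (fst p * fst (snd q) - fst (snd p) * fst q) / 2)"
  by (cases p; cases q) simp

lemma koranyi_gauge_eq:
  "koranyi_gauge q = root 4 (((fst q)\<^sup>2 + (fst (snd q))\<^sup>2)\<^sup>2 + 16 * (snd (snd q))\<^sup>2)"
  by (cases q) simp

lemma heis_inv_eq: "heis_inv q = (- fst q, - fst (snd q), - snd (snd q))"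
  by (cases q) simp

lemma continuous_on_heis_mult [continuous_intros]:
  "continuous_on S f \<Longrightarrow> continuous_on S g \<Longrightarrow> continuous_on S (\<lambda>x. f x \<star> g x)"
  unfolding heis_mult_eq by (intro continuous_intros) auto

lemma continuous_on_heis_dist [continuous_intros]:
  "continuous_on S f \<Longrightarrow> continuous_on S g \<Longrightarrow> continuous_on S (\<lambda>x. heis_dist (f x) (g x))"
  unfolding heis_dist_def heis_mult_eq heis_inv_eq koranyi_gauge_eq
  by (intro continuous_intros) auto

lemma open_heis_ball: "open (heis_ball q r)"
  unfolding heis_ball_def by (intro open_Collect_less continuous_intros)

text \<open>The strict sublevel sets are unions of open balls, hence open. Over the empty set the
  infimum is a constant.\<close>

lemma borel_measurable_heis_setdist [measurable]:
  "(\<lambda>q. heis_setdist q S) \<in> borel_measurable borel"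
proof (cases "S = {}")
  case True
  then show ?thesis by (simp add: heis_setdist_def)
next
  case False
  have bdd: "bdd_below ((\<lambda>p. heis_dist q p) ` S)" for q
    by (rule bdd_belowI2[where m = 0]) simp
  show ?thesis
  proof (rule borel_measurableI_less)
    fix y
    have "{q. heis_setdist q S < y} = (\<Union>p\<in>S. heis_ball p y)"
      using False by (auto simp: heis_setdist_def heis_ball_def cINF_less_iff bdd heis_dist_commute)
    then have "open {q. heis_setdist q S < y}" by (auto intro: open_heis_ball)
    then show "{q \<in> space borel. heis_setdist q S < y} \<in> sets borel" by simp
  qed
qed

section \<open>Single steps of the walk\<close>

definition walk_radius :: "heis set \<Rightarrow> real \<Rightarrow> heis \<Rightarrow> real" where
  "walk_radius D \<epsilon> q = min \<epsilon> (heis_setdist q (frontier D))"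

definition walk_step :: "heis set \<Rightarrow> real \<Rightarrow> heis \<Rightarrow> real \<times> real \<Rightarrow> heis" where
  "walk_step D \<epsilon> q w = q \<star> (walk_radius D \<epsilon> q * fst w, walk_radius D \<epsilon> q * snd w, 0)"

lemma heis_walk_Suc: "heis_walk D \<epsilon> q \<omega> (Suc n) = walk_step D \<epsilon> (heis_walk D \<epsilon> q \<omega> n) (\<omega> n)"
  by (simp add: walk_step_def walk_radius_def Let_def split: prod.split)

text \<open>From here on the recursion is unfolded only through \<open>heis_walk_Suc\<close>, which
  keeps \<open>walk_step\<close> folded.\<close>

declare heis_walk.simps(2) [simp del]

text \<open>The Markov property at the level of paths: removing the first step restarts the walk at
  its first position. Every induction on time below rests on it.\<close>

lemma heis_walk_case_nat:
  "heis_walk D \<epsilon> q (case_nat w \<omega>) (Suc n) = heis_walk D \<epsilon> (walk_step D \<epsilon> q w) \<omega> n"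
proof (induction n)
  case 0
  show ?case by (simp add: heis_walk_Suc)
next
  case (Suc n)
  have "heis_walk D \<epsilon> q (case_nat w \<omega>) (Suc (Suc n))
      = walk_step D \<epsilon> (heis_walk D \<epsilon> q (case_nat w \<omega>) (Suc n)) (\<omega> n)"
    by (subst heis_walk_Suc) simp
  then show ?case by (simp add: Suc heis_walk_Suc[symmetric])
qed

lemma walk_radius_le: "walk_radius D \<epsilon> q \<le> \<epsilon>"
  by (simp add: walk_radius_def)

lemma walk_radius_nonneg:
  assumes "frontier D \<noteq> {}" "0 \<le> \<epsilon>"
  shows "0 \<le> walk_radius D \<epsilon> q"
  using assms by (auto simp: walk_radius_def heis_setdist_def intro: cINF_greatest)

lemma walk_radius_le_dist:
  assumes "p \<in> frontier D"
  shows "walk_radius D \<epsilon> q \<le> heis_dist q p"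
proof -
  have "heis_setdist q (frontier D) \<le> heis_dist q p"
    unfolding heis_setdist_def using assms
    by (intro cINF_lower bdd_belowI2[where m = 0]) simp_all
  then show ?thesis by (simp add: walk_radius_def)
qed

text \<open>Move continuously from \<open>q\<close> to the new position by scaling the step with
  \<open>t\<close>. If the end lay outside \<open>D\<close>, this path would meet the boundary at a
  point whose distance from \<open>q\<close> is \<open>l * (t * norm w)\<close>, whereas
  \<open>l\<close> is at most that distance and \<open>norm w < 1\<close>.\<close>

lemma walk_step_in:
  assumes "open D" "frontier D \<noteq> {}" "0 \<le> \<epsilon>" "q \<in> D" "w \<in> disc"
  shows "walk_step D \<epsilon> q w \<in> D"
proof (rule ccontr)
  define l where "l = walk_radius D \<epsilon> q"
  define \<gamma> where "\<gamma> t = q \<star> (t * (l * fst w), t * (l * snd w), 0)" for t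
  have l0: "0 \<le> l" unfolding l_def using assms by (intro walk_radius_nonneg)
  assume "walk_step D \<epsilon> q w \<notin> D"
  then have "\<gamma> 1 \<notin> D" by (simp add: \<gamma>_def walk_step_def l_def)
  moreover have "\<gamma> 0 \<in> D" using assms by (cases q) (simp add: \<gamma>_def)
  moreover have "connected (\<gamma> ` {0..1})"
    unfolding \<gamma>_def by (intro connected_continuous_image continuous_intros) auto
  moreover have "\<gamma> 0 \<in> \<gamma> ` {0..1}" "\<gamma> 1 \<in> \<gamma> ` {0..1}" by simp_all
  ultimately have "\<gamma> ` {0..1} \<inter> frontier D \<noteq> {}"
    by (intro connected_Int_frontier) blast+
  then obtain t where t: "0 \<le> t" "t \<le> 1" "\<gamma> t \<in> frontier D" by auto
  have "l \<le> heis_dist q (\<gamma> t)"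
    unfolding l_def by (rule walk_radius_le_dist[OF t(3)])
  also have "heis_dist q (\<gamma> t) = norm ((t * l) *\<^sub>R w)"
    unfolding \<gamma>_def heis_dist_mult_horizontal by (cases w) (simp add: mult.assoc)
  also have "\<dots> = l * (t * norm w)" using t l0 by (simp add: abs_mult)
  finally have le: "l \<le> l * (t * norm w)" .
  have "t * norm w \<le> norm w" using t by (simp add: mult_left_le_one_le)
  then have "t * norm w < 1" using disc_norm[OF assms(5)] by linarith
  \<comment> \<open>In the remaining degenerate case the path is constant, so \<open>q\<close>
    itself would be a boundary point of the open set \<open>D\<close>.\<close>
  with le l0 have "l = 0" by (metis mult_less_cancel_left2 not_less order_le_less)
  then have "\<gamma> t = q" by (cases q) (simp add: \<gamma>_def)
  with t(3) assms show False by (simp add: frontier_def interior_open)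
qed

lemma walk_step_dist:
  assumes "frontier D \<noteq> {}" "0 \<le> \<epsilon>" "w \<in> disc"
  shows "heis_dist q (walk_step D \<epsilon> q w) \<le> \<epsilon>"
proof -
  define l where "l = walk_radius D \<epsilon> q"
  have l: "0 \<le> l" "l \<le> \<epsilon>" unfolding l_def using assms by (auto intro: walk_radius_nonneg walk_radius_le)
  have "heis_dist q (walk_step D \<epsilon> q w) = norm (l *\<^sub>R w)"
    unfolding walk_step_def heis_dist_mult_horizontal l_def[symmetric] by (cases w) simp
  also have "\<dots> \<le> l * 1" using l disc_norm[OF assms(3)] by (simp add: mult_left_le)
  finally show ?thesis using l by simp
qed

subsection \<open>First-step analysis\<close>

lemma measurable_walk_step [measurable]:
  assumes [measurable]: "f \<in> borel_measurable N" "g \<in> measurable N disc_measure"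
  shows "(\<lambda>x. walk_step D \<epsilon> (f x) (g x)) \<in> borel_measurable N"
proof -
  have g [measurable]: "(\<lambda>x. fst (g x)) \<in> borel_measurable N" "(\<lambda>x. snd (g x)) \<in> borel_measurable N"
    by (rule measurable_compose[OF assms(2)] measurable_disc_measure borel_measurable_fst_snd)+
  have r [measurable]: "(\<lambda>x. walk_radius D \<epsilon> (f x)) \<in> borel_measurable N"
    unfolding walk_radius_def
    by (intro borel_measurable_min borel_measurable_const
        measurable_compose[OF assms(1) borel_measurable_heis_setdist])
  show ?thesis unfolding walk_step_def
    by (intro borel_measurable_continuous_Pair[where H = heis_mult] assms(1) borel_measurable_Pair
        borel_measurable_times g r borel_measurable_const continuous_on_heis_mult
        continuous_on_fst continuous_on_snd continuous_on_id)
qed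

interpretation walk: sequence_space disc_measure
  by unfold_locales

lemma walk_space_eq: "walk_space = walk.S"
  by (simp add: walk_space_def)

interpretation walk_space: prob_space walk_space
  unfolding walk_space_eq by unfold_locales

lemma space_walk_space: "space walk_space = (UNIV \<rightarrow>\<^sub>E disc)"
  by (simp add: walk_space_def space_PiM space_disc_measure)

lemma measurable_walk_case_nat [measurable]:
  "f \<in> measurable N disc_measure \<Longrightarrow> g \<in> measurable N walk_space
    \<Longrightarrow> (\<lambda>x. case_nat (f x) (g x)) \<in> measurable N walk_space"
  unfolding walk_space_def by (rule measurable_case_nat')

lemma measurable_heis_walk [measurable]:
  "(\<lambda>\<omega>. heis_walk D \<epsilon> q \<omega> n) \<in> borel_measurable walk_space"
proof (induction n)
  case (Suc n)
  have "(\<lambda>\<omega>. \<omega> n) \<in> measurable walk_space disc_measure"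
    unfolding walk_space_def by (rule measurable_component_singleton) simp
  with Suc show ?case unfolding heis_walk_Suc by (rule measurable_walk_step)
qed simp

text \<open>Prepending an independent step to a random sequence reproduces the product measure;
  Tonelli then separates the first step from the rest.\<close>

lemma nn_integral_walk_space:
  assumes [measurable]: "f \<in> borel_measurable walk_space"
  shows "(\<integral>\<^sup>+\<omega>. f \<omega> \<partial>walk_space) = (\<integral>\<^sup>+w. (\<integral>\<^sup>+\<omega>. f (case_nat w \<omega>) \<partial>walk_space) \<partial>disc_measure)"
proof -
  have [measurable]: "(\<lambda>(s, \<omega>). case_nat s \<omega>) \<in> measurable (disc_measure \<Otimes>\<^sub>M walk_space) walk_space"
    by measurable
  have "(\<integral>\<^sup>+\<omega>. f \<omega> \<partial>walk_space)
      = (\<integral>\<^sup>+\<omega>. f \<omega> \<partial>distr (disc_measure \<Otimes>\<^sub>M walk_space) walk_space (\<lambda>(s, \<omega>). case_nat s \<omega>))"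
    using walk.PiM_iter by (simp only: walk_space_eq)
  also have "\<dots> = (\<integral>\<^sup>+x. f (case_nat (fst x) (snd x)) \<partial>(disc_measure \<Otimes>\<^sub>M walk_space))"
    by (subst nn_integral_distr) (auto simp: case_prod_beta)
  also have "\<dots> = (\<integral>\<^sup>+w. (\<integral>\<^sup>+\<omega>. f (case_nat w \<omega>) \<partial>walk_space) \<partial>disc_measure)"
    by (subst walk_space.nn_integral_fst[symmetric]) simp_all
  finally show ?thesis .
qed

lemma case_nat_in_walk_space:
  "w \<in> disc \<Longrightarrow> \<omega> \<in> space walk_space \<Longrightarrow> case_nat w \<omega> \<in> space walk_space"
  by (auto simp: space_walk_space PiE_iff split: nat.split)

text \<open>Conditioning an event on the first step. The measurability claim is what allows
  constants to be pulled out of the resulting integral.\<close>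

lemma emeasure_walk_space:
  assumes P: "Measurable.pred walk_space P"
  shows "emeasure walk_space {\<omega> \<in> space walk_space. P \<omega>}
      = (\<integral>\<^sup>+w. emeasure walk_space {\<omega> \<in> space walk_space. P (case_nat w \<omega>)} \<partial>disc_measure)"
    and "(\<lambda>w. emeasure walk_space {\<omega> \<in> space walk_space. P (case_nat w \<omega>)}) \<in> borel_measurable disc_measure"
proof -
  define A where "A = {\<omega> \<in> space walk_space. P \<omega>}"
  have A [measurable]: "A \<in> sets walk_space" unfolding A_def using P by simp
  have c: "(\<lambda>\<omega>. case_nat w \<omega>) \<in> measurable walk_space walk_space" if "w \<in> disc" for w
    using that by (intro measurable_walk_case_nat) (auto simp: space_disc_measure)
  \<comment> \<open>Only \<open>w\<close> in the disc is considered: for such \<open>w\<close> the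
    prepended sequence stays in the space of the product measure, and no other \<open>w\<close> lies
    in the space of \<open>disc_measure\<close>.\<close>
  have eq: "emeasure walk_space {\<omega> \<in> space walk_space. P (case_nat w \<omega>)}
      = (\<integral>\<^sup>+\<omega>. indicator A (case_nat w \<omega>) \<partial>walk_space)" if "w \<in> disc" for w
  proof -
    have e: "{\<omega> \<in> space walk_space. P (case_nat w \<omega>)} = case_nat w -` A \<inter> space walk_space"
      using case_nat_in_walk_space[OF that] by (auto simp: A_def)
    have "case_nat w -` A \<inter> space walk_space \<in> sets walk_space"
      by (rule measurable_sets[OF c[OF that] A])
    then have "emeasure walk_space {\<omega> \<in> space walk_space. P (case_nat w \<omega>)}
      = (\<integral>\<^sup>+\<omega>. indicator (case_nat w -` A \<inter> space walk_space) \<omega> \<partial>walk_space)"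
      unfolding e by (rule nn_integral_indicator[symmetric])
    also have "\<dots> = (\<integral>\<^sup>+\<omega>. indicator A (case_nat w \<omega>) \<partial>walk_space)"
      by (rule nn_integral_cong) (simp add: indicator_def)
    finally show ?thesis .
  qed
  have "emeasure walk_space A = (\<integral>\<^sup>+\<omega>. indicator A \<omega> \<partial>walk_space)" by simp
  also have "\<dots> = (\<integral>\<^sup>+w. (\<integral>\<^sup>+\<omega>. indicator A (case_nat w \<omega>) \<partial>walk_space) \<partial>disc_measure)"
    by (rule nn_integral_walk_space) simp
  also have "\<dots> = (\<integral>\<^sup>+w. emeasure walk_space {\<omega> \<in> space walk_space. P (case_nat w \<omega>)} \<partial>disc_measure)"
    by (rule nn_integral_cong) (simp add: eq space_disc_measure)
  finally show "emeasure walk_space {\<omega> \<in> space walk_space. P \<omega>}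
      = (\<integral>\<^sup>+w. emeasure walk_space {\<omega> \<in> space walk_space. P (case_nat w \<omega>)} \<partial>disc_measure)"
    unfolding A_def .
  have "(\<lambda>w. \<integral>\<^sup>+\<omega>. indicator A (case_nat w \<omega>) \<partial>walk_space) \<in> borel_measurable disc_measure"
    by measurable
  then show "(\<lambda>w. emeasure walk_space {\<omega> \<in> space walk_space. P (case_nat w \<omega>)}) \<in> borel_measurable disc_measure"
    by (rule measurable_cong[THEN iffD1, rotated]) (simp add: eq space_disc_measure)
qed

section \<open>The one-step mean \<open>T\<close> and the maximal inequality\<close>

definition walk_mean :: "heis set \<Rightarrow> real \<Rightarrow> (heis \<Rightarrow> ennreal) \<Rightarrow> heis \<Rightarrow> ennreal" where
  "walk_mean D \<epsilon> f q = (\<integral>\<^sup>+w. f (walk_step D \<epsilon> q w) \<partial>disc_measure)"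

lemma borel_measurable_walk_mean [measurable]:
  assumes [measurable]: "f \<in> borel_measurable borel"
  shows "walk_mean D \<epsilon> f \<in> borel_measurable borel"
  unfolding walk_mean_def by measurable

lemma borel_measurable_walk_mean_power:
  "f \<in> borel_measurable borel \<Longrightarrow> (walk_mean D \<epsilon> ^^ n) f \<in> borel_measurable borel"
  by (induction n) auto

lemma walk_mean_mono:
  assumes "open D" "frontier D \<noteq> {}" "0 \<le> \<epsilon>" "q \<in> D" "\<And>p. p \<in> D \<Longrightarrow> f p \<le> g p"
  shows "walk_mean D \<epsilon> f q \<le> walk_mean D \<epsilon> g q"
  unfolding walk_mean_def using walk_step_in[OF assms(1-4)] assms(5)
  by (intro nn_integral_mono) (simp add: space_disc_measure)

text \<open>Doob's maximal inequality for the supermartingale \<open>W (Q\<^sub>n)\<close>, by first-step analysis.\<close>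
lemma walk_hitting:
  assumes D: "open D" "frontier D \<noteq> {}" "0 \<le> \<epsilon>"
    and W [measurable]: "W \<in> borel_measurable borel"
    and super: "\<And>p. p \<in> D \<Longrightarrow> walk_mean D \<epsilon> W p \<le> W p"
    and S [measurable]: "S \<in> sets borel" and c: "\<And>p. p \<in> D \<Longrightarrow> p \<in> S \<Longrightarrow> c \<le> W p"
    and q: "q \<in> D"
  shows "c * emeasure walk_space {\<omega> \<in> space walk_space. \<exists>n. heis_walk D \<epsilon> q \<omega> n \<in> S} \<le> W q"
proof -
  \<comment> \<open>A finite horizon makes induction on time possible; the horizon is sent to
    infinity at the end.\<close>
  define A where "A q N = {\<omega> \<in> space walk_space. \<exists>n\<le>N. heis_walk D \<epsilon> q \<omega> n \<in> S}" for q N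
  have A [measurable]: "A q N \<in> sets walk_space" for q N
    unfolding A_def by measurable
  have one: "c * emeasure walk_space X \<le> c" for X
    using mult_left_mono[OF walk_space.emeasure_le_1, of c X] by simp
  have fin: "c * emeasure walk_space (A q N) \<le> W q" if "q \<in> D" for N
    using that
  proof (induction N arbitrary: q)
    case 0
    show ?case
    proof (cases "q \<in> S")
      case True
      \<comment> \<open>The set is already hit at time zero, where \<open>W q\<close> is at least
        \<open>c\<close>, and a probability is at most one.\<close>
      then show ?thesis using one c[OF 0 True] by (blast intro: order.trans)
    next
      case False
      then have "A q 0 = {}" by (simp add: A_def)
      then show ?thesis by simp
    qed
  next
    case (Suc N)
    show ?case
    proof (cases "q \<in> S")
      case True
      then show ?thesis using one c[OF Suc.prems True] by (blast intro: order.trans)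
    next
      case False
      \<comment> \<open>Since the start is not in \<open>S\<close>, a hit within
        \<open>Suc N\<close> steps is a hit within \<open>N\<close> steps after the first
        one.\<close>
      have ex: "(\<exists>n\<le>Suc N. heis_walk D \<epsilon> q (case_nat w \<omega>) n \<in> S)
          \<longleftrightarrow> (\<exists>n\<le>N. heis_walk D \<epsilon> (walk_step D \<epsilon> q w) \<omega> n \<in> S)" for w \<omega>
      proof
        assume "\<exists>n\<le>Suc N. heis_walk D \<epsilon> q (case_nat w \<omega>) n \<in> S"
        then obtain n where n: "n \<le> Suc N" "heis_walk D \<epsilon> q (case_nat w \<omega>) n \<in> S" by blast
        with False obtain m where "n = Suc m" by (cases n) auto
        with n show "\<exists>n\<le>N. heis_walk D \<epsilon> (walk_step D \<epsilon> q w) \<omega> n \<in> S"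
          by (auto simp: heis_walk_case_nat)
      next
        assume "\<exists>n\<le>N. heis_walk D \<epsilon> (walk_step D \<epsilon> q w) \<omega> n \<in> S"
        then obtain n where "n \<le> N" "heis_walk D \<epsilon> (walk_step D \<epsilon> q w) \<omega> n \<in> S" by blast
        then show "\<exists>n\<le>Suc N. heis_walk D \<epsilon> q (case_nat w \<omega>) n \<in> S"
          by (intro exI[of _ "Suc n"]) (simp add: heis_walk_case_nat)
      qed
      have P: "Measurable.pred walk_space (\<lambda>\<omega>. \<exists>n\<le>Suc N. heis_walk D \<epsilon> q \<omega> n \<in> S)"
        by measurable
      note E = emeasure_walk_space[OF P, unfolded ex, folded A_def]
      have "c * emeasure walk_space (A q (Suc N))
          = (\<integral>\<^sup>+w. c * emeasure walk_space (A (walk_step D \<epsilon> q w) N) \<partial>disc_measure)"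
        unfolding E(1) by (rule nn_integral_cmult[symmetric, OF E(2)])
      also have "\<dots> \<le> walk_mean D \<epsilon> W q"
        unfolding walk_mean_def using walk_step_in[OF D Suc.prems]
        by (intro nn_integral_mono Suc.IH) (simp add: space_disc_measure)
      also have "\<dots> \<le> W q" by (rule super[OF Suc.prems])
      finally show ?thesis .
    qed
  qed
  have "{\<omega> \<in> space walk_space. \<exists>n. heis_walk D \<epsilon> q \<omega> n \<in> S} = (\<Union>N. A q N)"
    by (auto simp: A_def)
  \<comment> \<open>Continuity from below of the measure along increasing horizons.\<close>
  also have "emeasure walk_space (\<Union>N. A q N) = (SUP N. emeasure walk_space (A q N))"
  proof (rule SUP_emeasure_incseq[symmetric])
    show "incseq (A q)"
    proof (rule monoI)
      fix M N :: nat assume "M \<le> N"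
      then show "A q M \<subseteq> A q N" unfolding A_def by (blast intro: order.trans)
    qed
  qed auto
  finally show ?thesis using fin[OF q] by (simp add: SUP_mult_left_ennreal SUP_le_iff)
qed

subsection \<open>Almost sure convergence\<close>

text \<open>Integrating the pointwise bound leaves the constant plus the trace. Because
  \<open>ennreal\<close> truncates negative reals to zero, the second conclusion is recorded so that
  the bound can later be combined with other terms as a real number.\<close>

lemma walk_mean_le_quadratic:
  assumes q: "open D" "frontier D \<noteq> {}" "0 \<le> \<epsilon>" "q \<in> D" and h: "\<And>p. p \<in> D \<Longrightarrow> 0 \<le> h p"
    and le: "\<And>a b. (a, b) \<in> disc \<Longrightarrow>
      h (walk_step D \<epsilon> q (a, b)) \<le> k0 + k1 * a + k2 * b + k3 * a\<^sup>2 + k4 * (a * b) + k5 * b\<^sup>2"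
  shows "walk_mean D \<epsilon> (\<lambda>p. ennreal (h p)) q \<le> ennreal (k0 + (k3 + k5) * disc_moment)"
    and "0 \<le> k0 + (k3 + k5) * disc_moment"
proof -
  define f where "f w = k0 + k1 * fst w + k2 * snd w + k3 * (fst w)\<^sup>2 + k4 * (fst w * snd w) + k5 * (snd w)\<^sup>2" for w
  have f: "integrable disc_measure f" "(\<integral>w. f w \<partial>disc_measure) = k0 + (k3 + k5) * disc_moment"
    unfolding f_def by (rule disc_quadratic)+
  have hf: "h (walk_step D \<epsilon> q w) \<le> f w" if "w \<in> disc" for w
    using le[of "fst w" "snd w"] that by (simp only: prod.collapse f_def)
  have nonneg: "0 \<le> f w" if "w \<in> disc" for w
    by (rule order.trans[OF h[OF walk_step_in[OF q that]] hf[OF that]])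
  have "walk_mean D \<epsilon> (\<lambda>p. ennreal (h p)) q \<le> (\<integral>\<^sup>+w. ennreal (f w) \<partial>disc_measure)"
    unfolding walk_mean_def by (intro nn_integral_mono ennreal_leI hf) (simp only: space_disc_measure)
  also have "\<dots> = ennreal (\<integral>w. f w \<partial>disc_measure)"
    by (rule nn_integral_eq_integral[OF f(1)], rule AE_I2) (simp only: space_disc_measure nonneg)
  finally show "walk_mean D \<epsilon> (\<lambda>p. ennreal (h p)) q \<le> ennreal (k0 + (k3 + k5) * disc_moment)"
    by (simp only: f(2))
  have "0 \<le> (\<integral>w. f w \<partial>disc_measure)"
    by (rule integral_nonneg_AE, rule AE_I2) (simp only: space_disc_measure nonneg)
  then show "0 \<le> k0 + (k3 + k5) * disc_moment" by (simp only: f(2))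
qed

section \<open>Quadratic variation of the walk\<close>

lemma walk_step_coords:
  "walk_step D \<epsilon> (x, y, z) (a, b) = (let l = walk_radius D \<epsilon> (x, y, z)
    in (x + l * a, y + l * b, z + l * (x * b - y * a) / 2))"
  by (simp add: walk_step_def Let_def algebra_simps)

text \<open>The mean squared length of the next horizontal displacement.\<close>

definition walk_energy :: "heis set \<Rightarrow> real \<Rightarrow> heis \<Rightarrow> ennreal" where
  "walk_energy D \<epsilon> q = ennreal (2 * (walk_radius D \<epsilon> q)\<^sup>2 * disc_moment)"

text \<open>The expected quadratic variation of the horizontal part from time \<open>m\<close> on:
  the \<open>n\<close>-th iterate of the mean is the expectation after \<open>n\<close>
  steps.\<close>

definition walk_tail :: "heis set \<Rightarrow> real \<Rightarrow> nat \<Rightarrow> heis \<Rightarrow> ennreal" where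
  "walk_tail D \<epsilon> m q = (\<Sum>n. (walk_mean D \<epsilon> ^^ (n + m)) (walk_energy D \<epsilon>) q)"

lemma borel_measurable_walk_energy [measurable]: "walk_energy D \<epsilon> \<in> borel_measurable borel"
  unfolding walk_energy_def walk_radius_def
  by (intro measurable_compose[OF _ measurable_ennreal] borel_measurable_times borel_measurable_power
      borel_measurable_const borel_measurable_min borel_measurable_heis_setdist)

lemma borel_measurable_walk_energy_iterate [measurable]:
  "(walk_mean D \<epsilon> ^^ n) (walk_energy D \<epsilon>) \<in> borel_measurable borel"
  by (intro borel_measurable_walk_mean_power borel_measurable_walk_energy)

lemma borel_measurable_walk_tail [measurable]: "walk_tail D \<epsilon> m \<in> borel_measurable borel"
  unfolding walk_tail_def by (intro borel_measurable_suminf_order borel_measurable_walk_energy_iterate)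

lemma walk_mean_suminf:
  assumes "\<And>n. f n \<in> borel_measurable borel"
  shows "walk_mean D \<epsilon> (\<lambda>p. \<Sum>n. f n p) q = (\<Sum>n. walk_mean D \<epsilon> (f n) q)"
  unfolding walk_mean_def 
  by (intro nn_integral_suminf measurable_compose[OF _ assms] measurable_walk_step) simp_all

text \<open>Together with \<open>walk_tail_0\<close> this says that the mean of
  \<open>walk_tail\<close> at index \<open>0\<close> drops by exactly one \<open>walk_energy\<close>
  per step, so a multiple of it compensates any growth controlled by the energy.\<close>

lemma walk_mean_walk_tail: "walk_mean D \<epsilon> (walk_tail D \<epsilon> m) q = walk_tail D \<epsilon> (Suc m) q"
proof -
  have "walk_mean D \<epsilon> (\<lambda>p. \<Sum>n. (walk_mean D \<epsilon> ^^ (n + m)) (walk_energy D \<epsilon>) p) q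
      = (\<Sum>n. walk_mean D \<epsilon> ((walk_mean D \<epsilon> ^^ (n + m)) (walk_energy D \<epsilon>)) q)"
    by (intro walk_mean_suminf borel_measurable_walk_energy_iterate)
  then show ?thesis by (simp add: walk_tail_def[abs_def])
qed

lemma walk_tail_0: "walk_tail D \<epsilon> 0 q = walk_energy D \<epsilon> q + walk_tail D \<epsilon> 1 q"
  unfolding walk_tail_def
  by (subst suminf_offset[where i = 1]) (simp_all add: add.commute)

lemma dist_heis_power2:
  "(dist (x, y, z) ((x', y', z') :: heis))\<^sup>2 = (x - x')\<^sup>2 + (y - y')\<^sup>2 + (z - z')\<^sup>2"
  by (simp add: dist_Pair_Pair dist_real_def)

text \<open>The horizontal coordinates are martingales, so the mean of the squared horizontal length
  grows by exactly the energy. Subtracting it from the bound \<open>R\<close> gives a nonnegative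
  reservoir from which the energy is paid.\<close>

lemma walk_mean_horizontal:
  assumes D: "open D" "frontier D \<noteq> {}" "0 \<le> \<epsilon>"
    and R: "\<And>p. p \<in> D \<Longrightarrow> (fst p)\<^sup>2 + (fst (snd p))\<^sup>2 \<le> R" and q: "q \<in> D"
  defines "\<phi> \<equiv> \<lambda>p. R - ((fst p)\<^sup>2 + (fst (snd p))\<^sup>2)"
  shows "walk_energy D \<epsilon> q + walk_mean D \<epsilon> (\<lambda>p. ennreal (\<phi> p)) q \<le> ennreal (\<phi> q)"
proof -
  obtain x y z where xyz: "q = (x, y, z)" by (cases q)
  define l where "l = walk_radius D \<epsilon> q"
  have \<phi>0: "0 \<le> \<phi> p" if "p \<in> D" for p using R[OF that] by (simp add: \<phi>_def)
  have eq: "\<phi> (walk_step D \<epsilon> q (a, b)) = \<phi> q + (- 2 * x * l) * a + (- 2 * y * l) * b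
      + (- (l\<^sup>2)) * a\<^sup>2 + 0 * (a * b) + (- (l\<^sup>2)) * b\<^sup>2" for a b
    unfolding \<phi>_def xyz walk_step_coords Let_def l_def[unfolded xyz, symmetric] fst_conv snd_conv
    by (simp add: power2_sum power_mult_distrib)
  have m: "walk_mean D \<epsilon> (\<lambda>p. ennreal (\<phi> p)) q \<le> ennreal (\<phi> q + (- (l\<^sup>2) + - (l\<^sup>2)) * disc_moment)"
    "0 \<le> \<phi> q + (- (l\<^sup>2) + - (l\<^sup>2)) * disc_moment"
    by (rule walk_mean_le_quadratic[OF D q _ eq_refl[OF eq]], erule \<phi>0)+
  have "walk_energy D \<epsilon> q + walk_mean D \<epsilon> (\<lambda>p. ennreal (\<phi> p)) q
      \<le> walk_energy D \<epsilon> q + ennreal (\<phi> q + (- (l\<^sup>2) + - (l\<^sup>2)) * disc_moment)"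
    by (rule add_left_mono[OF m(1)])
  also have "\<dots> = ennreal (\<phi> q)"
    unfolding walk_energy_def l_def[symmetric] using m(2) disc_moment_pos
    by (subst ennreal_plus[symmetric]) (simp_all add: algebra_simps)
  finally show ?thesis .
qed

text \<open>A bounded martingale has finite expected quadratic variation: by induction with
  \<open>walk_mean_horizontal\<close>, each partial sum is at most \<phi>.\<close>

lemma walk_tail_finite:
  assumes D: "open D" "frontier D \<noteq> {}" "0 \<le> \<epsilon>"
    and R: "\<And>p. p \<in> D \<Longrightarrow> (fst p)\<^sup>2 + (fst (snd p))\<^sup>2 \<le> R" and q: "q \<in> D"
  shows "walk_tail D \<epsilon> 0 q < \<infinity>"
proof -
  define g where "g n = (walk_mean D \<epsilon> ^^ n) (walk_energy D \<epsilon>)" for n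
  have g: "g n \<in> borel_measurable borel" for n
    unfolding g_def by (rule borel_measurable_walk_energy_iterate)
  define \<phi> where "\<phi> p = R - ((fst p)\<^sup>2 + (fst (snd p))\<^sup>2)" for p :: heis
  have sum: "(\<Sum>n<N. g n p) \<le> ennreal (\<phi> p)" if "p \<in> D" for N p
    using that
  proof (induction N arbitrary: p)
    case (Suc N)
    have "(\<Sum>n<Suc N. g n p) = walk_energy D \<epsilon> p + (\<Sum>n<N. walk_mean D \<epsilon> (g n) p)"
      unfolding sum.lessThan_Suc_shift by (simp add: g_def)
    also have "(\<Sum>n<N. walk_mean D \<epsilon> (g n) p) = walk_mean D \<epsilon> (\<lambda>p. \<Sum>n<N. g n p) p"
      unfolding walk_mean_def[of D \<epsilon> _ p]
      by (intro nn_integral_sum[symmetric] measurable_compose[OF _ g] measurable_walk_step) simp_all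
    also have "\<dots> \<le> walk_mean D \<epsilon> (\<lambda>p. ennreal (\<phi> p)) p"
      by (intro walk_mean_mono[OF D Suc.prems] Suc.IH)
    finally show ?case
      unfolding \<phi>_def using walk_mean_horizontal[OF D R Suc.prems]
      by (meson add_left_mono order.trans)
  qed simp
  have "walk_tail D \<epsilon> 0 q \<le> ennreal (\<phi> q)"
    unfolding walk_tail_def using sum[OF q] by (intro suminf_le_const) (simp_all add: g_def)
  then show ?thesis using ennreal_less_top[of "\<phi> q"] by (simp add: order.strict_trans1)
qed

text \<open>All three coordinates are martingales, so the linear terms average out. The vertical
  increment \<open>l * (x * b - y * a) / 2\<close> contributes a quarter of
  \<open>x\<^sup>2 + y\<^sup>2\<close>, which explains the factor \<open>1 + R / 8\<close> in front
  of the energy.\<close>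

lemma walk_mean_dist:
  assumes D: "open D" "frontier D \<noteq> {}" "0 \<le> \<epsilon>"
    and R: "\<And>p. p \<in> D \<Longrightarrow> (fst p)\<^sup>2 + (fst (snd p))\<^sup>2 \<le> R" and p: "p \<in> D"
  shows "walk_mean D \<epsilon> (\<lambda>p. ennreal ((dist p q)\<^sup>2)) p
    \<le> ennreal ((dist p q)\<^sup>2) + ennreal (1 + R / 8) * walk_energy D \<epsilon> p"
proof -
  obtain x y z where xyz: "p = (x, y, z)" by (cases p)
  obtain x' y' z' where xyz': "q = (x', y', z')" by (cases q)
  define l where "l = walk_radius D \<epsilon> p"
  have C: "0 \<le> 1 + R / 8" using R[OF p] zero_le_power2[of "fst p"] zero_le_power2[of "fst (snd p)"] by linarith
  have eq: "(dist (walk_step D \<epsilon> p (a, b)) q)\<^sup>2 = (dist p q)\<^sup>2 + (2 * l * (x - x') - l * y * (z - z')) * a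
      + (2 * l * (y - y') + l * x * (z - z')) * b + (l\<^sup>2 * (1 + y\<^sup>2 / 4)) * a\<^sup>2
      + (- (l\<^sup>2 * x * y / 2)) * (a * b) + (l\<^sup>2 * (1 + x\<^sup>2 / 4)) * b\<^sup>2" for a b
    unfolding xyz xyz' walk_step_coords Let_def l_def[unfolded xyz, symmetric] dist_heis_power2
    by (simp add: power2_eq_square field_simps)
  have "walk_mean D \<epsilon> (\<lambda>p. ennreal ((dist p q)\<^sup>2)) p
      \<le> ennreal ((dist p q)\<^sup>2 + (l\<^sup>2 * (1 + y\<^sup>2 / 4) + l\<^sup>2 * (1 + x\<^sup>2 / 4)) * disc_moment)"
    by (rule walk_mean_le_quadratic(1)[OF D p _ eq_refl[OF eq]]) simp
  also have "\<dots> \<le> ennreal ((dist p q)\<^sup>2 + (1 + R / 8) * (2 * l\<^sup>2 * disc_moment))"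
  proof (rule ennreal_leI)
    have "(l\<^sup>2 * disc_moment) * (2 + (x\<^sup>2 + y\<^sup>2) / 4) \<le> (l\<^sup>2 * disc_moment) * (2 * (1 + R / 8))"
      using R[OF p] disc_moment_pos unfolding xyz by (intro mult_left_mono) auto
    then show "(dist p q)\<^sup>2 + (l\<^sup>2 * (1 + y\<^sup>2 / 4) + l\<^sup>2 * (1 + x\<^sup>2 / 4)) * disc_moment
        \<le> (dist p q)\<^sup>2 + (1 + R / 8) * (2 * l\<^sup>2 * disc_moment)"
      by (simp add: algebra_simps)
  qed
  also have "\<dots> = ennreal ((dist p q)\<^sup>2) + ennreal (1 + R / 8) * walk_energy D \<epsilon> p"
    unfolding walk_energy_def l_def[symmetric] using C disc_moment_pos
    by (subst ennreal_plus) (simp_all add: ennreal_mult)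
  finally show ?thesis .
qed

text \<open>A Doob inequality for the walk after time \<open>m\<close>. For \<open>m = 0\<close> it
  is \<open>walk_hitting\<close> for a suitable supersolution; larger \<open>m\<close> reduce to
  smaller ones by averaging over the first step.\<close>

lemma walk_oscillation:
  assumes D: "open D" "frontier D \<noteq> {}" "0 \<le> \<epsilon>"
    and R: "\<And>p. p \<in> D \<Longrightarrow> (fst p)\<^sup>2 + (fst (snd p))\<^sup>2 \<le> R" and q: "q \<in> D" and s: "0 \<le> s"
  shows "ennreal (s\<^sup>2) * emeasure walk_space
      {\<omega> \<in> space walk_space. \<exists>k. s \<le> dist (heis_walk D \<epsilon> q \<omega> (m + k)) (heis_walk D \<epsilon> q \<omega> m)}
    \<le> ennreal (1 + R / 8) * walk_tail D \<epsilon> m q"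
  using q
proof (induction m arbitrary: q)
  case 0
  define C where "C = ennreal (1 + R / 8)"
  \<comment> \<open>The squared distance grows in mean by at most \<open>C\<close> times the energy,
    and the tail term loses exactly that amount. At \<open>q\<close> itself only the tail term
    remains.\<close>
  define W where "W p = ennreal ((dist p q)\<^sup>2) + C * walk_tail D \<epsilon> 0 p" for p
  have md: "(\<lambda>p. ennreal ((dist p q)\<^sup>2)) \<in> borel_measurable borel"
    by (intro measurable_compose[OF _ measurable_ennreal] borel_measurable_continuous_onI continuous_intros)
  have "ennreal (s\<^sup>2) * emeasure walk_space
      {\<omega> \<in> space walk_space. \<exists>n. heis_walk D \<epsilon> q \<omega> n \<in> {p. s \<le> dist p q}} \<le> W q"
  proof (rule walk_hitting[OF D _ _ _ _ 0])
    note [measurable] = md borel_measurable_walk_tail[of D \<epsilon> 0]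
    show "W \<in> borel_measurable borel" unfolding W_def by measurable
    show "{p. s \<le> dist p q} \<in> sets borel"
      by (intro borel_closed closed_Collect_le continuous_intros)
    show "ennreal (s\<^sup>2) \<le> W p" if "p \<in> {p. s \<le> dist p q}" for p
    proof -
      have "ennreal (s\<^sup>2) \<le> ennreal ((dist p q)\<^sup>2)"
        using that s by (intro ennreal_leI power_mono) auto
      also have "\<dots> \<le> W p" by (simp add: W_def)
      finally show ?thesis .
    qed
    show "walk_mean D \<epsilon> W p \<le> W p" if p: "p \<in> D" for p
    proof -
      have "walk_mean D \<epsilon> W p = walk_mean D \<epsilon> (\<lambda>p. ennreal ((dist p q)\<^sup>2)) p
          + C * walk_mean D \<epsilon> (walk_tail D \<epsilon> 0) p"
      proof -
        have "(\<lambda>w. walk_tail D \<epsilon> 0 (walk_step D \<epsilon> p w)) \<in> borel_measurable disc_measure"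
          "(\<lambda>w. ennreal ((dist (walk_step D \<epsilon> p w) q)\<^sup>2)) \<in> borel_measurable disc_measure"
          by (intro measurable_compose[OF _ borel_measurable_walk_tail] measurable_compose[OF _ md]
              measurable_walk_step; simp)+
        then show ?thesis
          unfolding W_def walk_mean_def by (simp add: nn_integral_add nn_integral_cmult)
      qed
      also have "\<dots> \<le> ennreal ((dist p q)\<^sup>2) + C * walk_energy D \<epsilon> p + C * walk_tail D \<epsilon> 1 p"
        unfolding C_def walk_mean_walk_tail One_nat_def
        by (intro add_right_mono walk_mean_dist[OF D R p])
      also have "\<dots> = W p"
        unfolding W_def walk_tail_0 by (simp add: distrib_left add.assoc)
      finally show ?thesis .
    qed
  qed
  then show ?case by (simp add: W_def C_def)
next
  case (Suc m)
  define B where "B q m = {\<omega> \<in> space walk_space. \<exists>k. s \<le> dist (heis_walk D \<epsilon> q \<omega> (m + k)) (heis_walk D \<epsilon> q \<omega> m)}" for q m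
  have "{\<omega> \<in> space walk_space. s \<le> dist (heis_walk D \<epsilon> q \<omega> i) (heis_walk D \<epsilon> q \<omega> j)} \<in> sets walk_space" for i j
    by (intro borel_measurable_le borel_measurable_const borel_measurable_dist measurable_heis_walk)
  then have P: "Measurable.pred walk_space
      (\<lambda>\<omega>. \<exists>k. s \<le> dist (heis_walk D \<epsilon> q \<omega> (Suc m + k)) (heis_walk D \<epsilon> q \<omega> (Suc m)))"
    by (intro pred_intros_countable) (simp add: pred_def)
  \<comment> \<open>Given the first step, the event for \<open>Suc m\<close> is the event for
    \<open>m\<close> of the walk started at the new position.\<close>
  have "{\<omega> \<in> space walk_space. \<exists>k. s \<le> dist (heis_walk D \<epsilon> q (case_nat w \<omega>) (Suc m + k))
      (heis_walk D \<epsilon> q (case_nat w \<omega>) (Suc m))} = B (walk_step D \<epsilon> q w) m" for w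
    by (simp only: B_def add_Suc heis_walk_case_nat)
  note E = emeasure_walk_space[OF P, unfolded this, folded B_def]
  have "ennreal (s\<^sup>2) * emeasure walk_space (B q (Suc m))
      = (\<integral>\<^sup>+w. ennreal (s\<^sup>2) * emeasure walk_space (B (walk_step D \<epsilon> q w) m) \<partial>disc_measure)"
    unfolding E(1) by (rule nn_integral_cmult[symmetric, OF E(2)])
  also have "\<dots> \<le> (\<integral>\<^sup>+w. ennreal (1 + R / 8) * walk_tail D \<epsilon> m (walk_step D \<epsilon> q w) \<partial>disc_measure)"
    using walk_step_in[OF D Suc.prems]
    by (intro nn_integral_mono) (simp add: space_disc_measure Suc.IH[folded B_def])
  also have "\<dots> = ennreal (1 + R / 8) * walk_mean D \<epsilon> (walk_tail D \<epsilon> m) q"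
    unfolding walk_mean_def
    by (intro nn_integral_cmult measurable_compose[OF _ borel_measurable_walk_tail] measurable_walk_step) simp_all
  finally show ?case unfolding walk_mean_walk_tail B_def .
qed

text \<open>Tails of a convergent series; finiteness is essential because they are written as
  differences in \<open>ennreal\<close>.\<close>

lemma walk_tail_tendsto:
  assumes "walk_tail D \<epsilon> 0 q < \<infinity>"
  shows "(\<lambda>m. walk_tail D \<epsilon> m q) \<longlonglongrightarrow> 0"
proof -
  define f where "f n = (walk_mean D \<epsilon> ^^ n) (walk_energy D \<epsilon>) q" for n
  have t: "walk_tail D \<epsilon> m q = (\<Sum>n. f (n + m))" for m by (simp add: walk_tail_def f_def)
  have fin: "suminf f < top" using assms t[of 0] by simp
  have eq: "walk_tail D \<epsilon> m q = suminf f - (\<Sum>n<m. f n)" for m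
  proof -
    have "suminf f = walk_tail D \<epsilon> m q + (\<Sum>n<m. f n)"
      unfolding t by (rule suminf_offset) simp
    moreover have "(\<Sum>n<m. f n) \<le> suminf f" by (rule sum_le_suminf) auto
    then have "(\<Sum>n<m. f n) \<noteq> top" using fin by (metis less_irrefl order.strict_trans1)
    ultimately show ?thesis by (simp add: ennreal_add_diff_cancel_right infinity_ennreal_def)
  qed
  have "(\<lambda>m. suminf f - (\<Sum>n<m. f n)) \<longlonglongrightarrow> suminf f - suminf f"
    using fin by (intro tendsto_diff_ennreal tendsto_const summable_LIMSEQ) auto
  then show ?thesis using fin unfolding eq by (simp add: ennreal_minus_eq_0)
qed

text \<open>By \<open>walk_oscillation\<close> the probability of moving by at least
  \<open>s\<close> after time \<open>m\<close> is controlled by \<open>walk_tail\<close>, which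
  tends to zero. Hence almost no path oscillates by \<open>s\<close> after every time; letting
  \<open>s\<close> run through \<open>1 / (j + 1)\<close> gives the Cauchy property.\<close>

lemma AE_walk_convergent:
  assumes D: "open D" "bounded D" "frontier D \<noteq> {}" "0 \<le> \<epsilon>" and q: "q \<in> D"
  shows "AE \<omega> in walk_space. convergent (heis_walk D \<epsilon> q \<omega>)"
proof -
  obtain M where M: "\<And>p. p \<in> D \<Longrightarrow> norm p \<le> M" using D(2) bounded_iff by metis
  have R: "(fst p)\<^sup>2 + (fst (snd p))\<^sup>2 \<le> M\<^sup>2" if "p \<in> D" for p
  proof -
    have "(fst p)\<^sup>2 + (fst (snd p))\<^sup>2 \<le> (norm p)\<^sup>2" by (cases p) (simp add: norm_Pair)
    also have "\<dots> \<le> M\<^sup>2" using M[OF that] by (intro power_mono) auto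
    finally show ?thesis .
  qed
  have ae: "AE \<omega> in walk_space. \<exists>m. \<forall>k. dist (heis_walk D \<epsilon> q \<omega> (m + k)) (heis_walk D \<epsilon> q \<omega> m) < inverse (Suc j)" for j
  proof -
    define s where "s = inverse (real (Suc j))"
    have s: "0 < s" by (simp add: s_def)
    define B where "B m = {\<omega> \<in> space walk_space. \<exists>k. s \<le> dist (heis_walk D \<epsilon> q \<omega> (m + k)) (heis_walk D \<epsilon> q \<omega> m)}" for m
    have B [measurable]: "B m \<in> sets walk_space" for m unfolding B_def by measurable
    have le: "ennreal (s\<^sup>2) * emeasure walk_space (\<Inter>m. B m) \<le> ennreal (1 + M\<^sup>2 / 8) * walk_tail D \<epsilon> m q" for m
    proof -
      have "ennreal (s\<^sup>2) * emeasure walk_space (\<Inter>m. B m) \<le> ennreal (s\<^sup>2) * emeasure walk_space (B m)"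
        by (intro mult_left_mono emeasure_mono) auto
      also have "\<dots> \<le> ennreal (1 + M\<^sup>2 / 8) * walk_tail D \<epsilon> m q"
        unfolding B_def by (rule walk_oscillation[OF D(1,3,4) R q less_imp_le[OF s]])
      finally show ?thesis .
    qed
    have "(\<lambda>m. ennreal (1 + M\<^sup>2 / 8) * walk_tail D \<epsilon> m q) \<longlonglongrightarrow> ennreal (1 + M\<^sup>2 / 8) * 0"
      by (intro ennreal_tendsto_cmult walk_tail_tendsto walk_tail_finite[OF D(1,3,4) R q]) simp
    \<comment> \<open>The left-hand side does not depend on \<open>m\<close>, so it is bounded by
      the limit of the right-hand sides.\<close>
    then have "ennreal (s\<^sup>2) * emeasure walk_space (\<Inter>m. B m) \<le> 0"
      using le by (intro LIMSEQ_le_const) auto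
    then have "emeasure walk_space (\<Inter>m. B m) = 0" using s by simp
    then have "(\<Inter>m. B m) \<in> null_sets walk_space" by (intro null_setsI) auto
    then have "AE \<omega> in walk_space. \<omega> \<notin> (\<Inter>m. B m)" by (rule AE_not_in)
    then show ?thesis
      by (rule AE_mp) (rule AE_I2, auto simp: B_def s_def not_le)
  qed
  then have "AE \<omega> in walk_space. \<forall>j. \<exists>m. \<forall>k. dist (heis_walk D \<epsilon> q \<omega> (m + k)) (heis_walk D \<epsilon> q \<omega> m) < inverse (Suc j)"
    by (simp add: AE_all_countable)
  then show ?thesis
  proof (rule AE_mp, intro AE_I2 impI)
    fix \<omega> assume j: "\<forall>j. \<exists>m. \<forall>k. dist (heis_walk D \<epsilon> q \<omega> (m + k)) (heis_walk D \<epsilon> q \<omega> m) < inverse (Suc j)"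
    have "Cauchy (heis_walk D \<epsilon> q \<omega>)"
      unfolding Cauchy_altdef2
    proof (intro allI impI)
      fix e :: real assume "0 < e"
      then obtain j where e: "inverse (Suc j) < e" using reals_Archimedean by blast
      from j obtain m where m: "\<And>k. dist (heis_walk D \<epsilon> q \<omega> (m + k)) (heis_walk D \<epsilon> q \<omega> m) < inverse (Suc j)" by blast
      show "\<exists>N. \<forall>n\<ge>N. dist (heis_walk D \<epsilon> q \<omega> n) (heis_walk D \<epsilon> q \<omega> N) < e"
      proof (intro exI[of _ m] allI impI)
        fix n assume "m \<le> n"
        then show "dist (heis_walk D \<epsilon> q \<omega> n) (heis_walk D \<epsilon> q \<omega> m) < e"
          using m[of "n - m"] e by simp
      qed
    qed
    then show "convergent (heis_walk D \<epsilon> q \<omega>)" by (rule Cauchy_convergent)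
  qed
qed

subsection \<open>Expansion of the fundamental solution\<close>

text \<open>The cubic Taylor polynomial lies below the function. With
  \<open>s = sqrt (1 + h)\<close>, the difference times \<open>16 * s\<close> is
  \<open>(s - 1) ^ 4\<close> times a polynomial with positive coefficients.\<close>

lemma inverse_sqrt_ge_cubic:
  fixes h :: real
  assumes "- 1 < h"
  shows "1 - h / 2 + 3 * h\<^sup>2 / 8 - 5 * h ^ 3 / 16 \<le> 1 / sqrt (1 + h)"
proof -
  define s where "s = sqrt (1 + h)"
  have s: "0 < s" "h = s\<^sup>2 - 1" using assms by (simp_all add: s_def)
  have "0 \<le> (s - 1) ^ 4 * (5 * s ^ 3 + 20 * s\<^sup>2 + 29 * s + 16)"
    using s by (intro mult_nonneg_nonneg add_nonneg_nonneg) auto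
  also have "\<dots> = 16 * (1 - (1 - h / 2 + 3 * h\<^sup>2 / 8 - 5 * h ^ 3 / 16) * s)"
    unfolding s(2) by (simp add: field_simps power2_eq_square power3_eq_cube power4_eq_xxxx)
  finally have "(1 - h / 2 + 3 * h\<^sup>2 / 8 - 5 * h ^ 3 / 16) * s \<le> 1" by simp
  then show ?thesis using s(1) unfolding s_def[symmetric] by (simp only: pos_le_divide_eq)
qed

text \<open>Substitutes the increment \<open>h\<close> into the cubic polynomial and keeps the
  orders one and two in \<open>l\<close>. The three error constants come from the three powers of
  \<open>h\<close>: \<open>B\<close> from \<open>h / 2\<close>, \<open>6 * 3 / 8 = 9 / 4\<close>
  from the square and \<open>64 * 5 / 16 = 20\<close> from the cube.\<close>

lemma cubic_remainder:
  fixes l B :: real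
  assumes l: "0 \<le> l" "l \<le> 1" and B: "\<bar>h1\<bar> \<le> B" "\<bar>h2\<bar> \<le> B" "\<bar>h3\<bar> \<le> B" "\<bar>h4\<bar> \<le> B"
  defines "h \<equiv> l * h1 + l\<^sup>2 * h2 + l ^ 3 * h3 + l ^ 4 * h4"
  shows "l * (- h1 / 2) + l\<^sup>2 * (3 * h1\<^sup>2 / 8 - h2 / 2) - (B + 9 * B\<^sup>2 / 4 + 20 * B ^ 3) * l ^ 3
    \<le> - h / 2 + 3 * h\<^sup>2 / 8 - 5 * h ^ 3 / 16"
proof -
  have B0: "0 \<le> B" using B(1) by linarith
  define r where "r = h2 + l * h3 + l\<^sup>2 * h4"
  have ll: "\<bar>l * t\<bar> \<le> B" if "\<bar>t\<bar> \<le> B" for t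
    using mult_mono[OF l(2) that] l by (simp add: abs_mult)
  have r: "\<bar>r\<bar> \<le> 3 * B"
    using B(2) ll[OF B(3)] ll[OF ll[OF B(4)]] unfolding r_def power2_eq_square by (simp add: mult.assoc)
  have h: "h = l * h1 + l\<^sup>2 * r"
    by (simp add: h_def r_def power2_eq_square power3_eq_cube power4_eq_xxxx algebra_simps)
  have l3: "0 \<le> l ^ 3" using l by simp
  have "h3 + l * h4 \<le> 2 * B" using B(3) ll[OF B(4)] by linarith
  then have "l ^ 3 * (h3 + l * h4) \<le> l ^ 3 * (2 * B)" using l3 by (rule mult_left_mono)
  moreover have "h / 2 = l * h1 / 2 + l\<^sup>2 * h2 / 2 + l ^ 3 * (h3 + l * h4) / 2"
    by (simp add: h_def power2_eq_square power3_eq_cube power4_eq_xxxx algebra_simps add_divide_distrib)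
  moreover have "l ^ 3 * (2 * B) = 2 * (B * l ^ 3)" by simp
  ultimately have 1: "h / 2 \<le> l * h1 / 2 + l\<^sup>2 * h2 / 2 + B * l ^ 3" by linarith
  have "\<bar>h1 * r\<bar> \<le> B * (3 * B)"
    unfolding abs_mult using B(1) r B0 by (intro mult_mono) auto
  then have "l ^ 3 * (- (3 * B\<^sup>2)) \<le> l ^ 3 * (h1 * r)"
    by (intro mult_left_mono l3) (simp add: power2_eq_square)
  moreover have "h\<^sup>2 = l\<^sup>2 * h1\<^sup>2 + 2 * (l ^ 3 * (h1 * r)) + (l\<^sup>2 * r)\<^sup>2"
    by (simp add: h power2_eq_square power3_eq_cube algebra_simps)
  moreover have "l ^ 3 * (- (3 * B\<^sup>2)) = - 3 * (B\<^sup>2 * l ^ 3)" by simp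
  ultimately have 2: "l\<^sup>2 * h1\<^sup>2 - 6 * (B\<^sup>2 * l ^ 3) \<le> h\<^sup>2"
    using zero_le_power2[of "l\<^sup>2 * r"] by linarith
  have "\<bar>h1 + l * r\<bar> \<le> 4 * B"
  proof -
    have "\<bar>l * r\<bar> \<le> 1 * (3 * B)" unfolding abs_mult using l r by (intro mult_mono) auto
    then show ?thesis using B(1) by linarith
  qed
  then have "\<bar>h\<bar> \<le> l * (4 * B)"
  proof -
    have "h = l * (h1 + l * r)" by (simp add: h power2_eq_square algebra_simps)
    then show ?thesis using l mult_left_mono[OF \<open>\<bar>h1 + l * r\<bar> \<le> 4 * B\<close> l(1)] by (simp add: abs_mult)
  qed
  then have "\<bar>h\<bar> ^ 3 \<le> (l * (4 * B)) ^ 3" by (rule power_mono) simp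
  moreover have "h ^ 3 \<le> \<bar>h\<bar> ^ 3" by (metis abs_ge_self power_abs)
  ultimately have 3: "h ^ 3 \<le> 64 * (B ^ 3 * l ^ 3)"
    by (simp add: power_mult_distrib algebra_simps)
  show ?thesis using 1 2 3 by (simp add: field_simps) 
qed

text \<open>The fourth power of the gauge, kept as a polynomial so that its change under a step can
  be computed exactly; \<open>1 / sqrt\<close> of it is the gauge to the power
  \<open>-2\<close>.\<close>

definition koranyi_quartic :: "heis \<Rightarrow> real" where
  "koranyi_quartic u = ((fst u)\<^sup>2 + (fst (snd u))\<^sup>2)\<^sup>2 + 16 * (snd (snd u))\<^sup>2"

text \<open>The quadratic part has trace zero because \<open>|u|\<^sub>K\<^sup>-\<^sup>2\<close> is harmonic for the sub-Laplacian.\<close>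
lemma koranyi_expansion:
  fixes M c :: real
  assumes c: "0 < c" and M: "1 \<le> M"
  obtains K where "0 < K"
    "\<And>x y z. \<bar>x\<bar> \<le> M \<Longrightarrow> \<bar>y\<bar> \<le> M \<Longrightarrow> \<bar>z\<bar> \<le> M \<Longrightarrow> c \<le> koranyi_quartic (x, y, z) \<Longrightarrow>
      \<exists>j1 j2 j3 j4. \<forall>l a b. 0 \<le> l \<longrightarrow> l \<le> 1 \<longrightarrow> (a, b) \<in> disc \<longrightarrow>
        0 < koranyi_quartic ((x, y, z) \<star> (l * a, l * b, 0)) \<longrightarrow>
        (1 + l * (j1 * a + j2 * b) + l\<^sup>2 * (j3 * a\<^sup>2 + j4 * (a * b) - j3 * b\<^sup>2) - K * l ^ 3)
          / sqrt (koranyi_quartic (x, y, z))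
        \<le> 1 / sqrt (koranyi_quartic ((x, y, z) \<star> (l * a, l * b, 0)))"
proof -
  \<comment> \<open>A common bound for the four coefficients of the relative increment: the sum of
    bounds for their numerators over the lower bound \<open>c\<close> of the denominator.\<close>
  define B where "B = (16 * M ^ 3 + 32 * M\<^sup>2 + 32 * M\<^sup>2 + 16 * M + 4) / c"
  define K where "K = B + 9 * B\<^sup>2 / 4 + 20 * B ^ 3"
  have "0 < B" using c M by (simp add: B_def add_pos_pos)
  then have "0 < K" by (simp add: K_def add_pos_pos)
  moreover have "\<exists>j1 j2 j3 j4. \<forall>l a b. 0 \<le> l \<longrightarrow> l \<le> 1 \<longrightarrow> (a, b) \<in> disc \<longrightarrow>
        0 < koranyi_quartic ((x, y, z) \<star> (l * a, l * b, 0)) \<longrightarrow>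
        (1 + l * (j1 * a + j2 * b) + l\<^sup>2 * (j3 * a\<^sup>2 + j4 * (a * b) - j3 * b\<^sup>2) - K * l ^ 3)
          / sqrt (koranyi_quartic (x, y, z))
        \<le> 1 / sqrt (koranyi_quartic ((x, y, z) \<star> (l * a, l * b, 0)))"
    if xyz: "\<bar>x\<bar> \<le> M" "\<bar>y\<bar> \<le> M" "\<bar>z\<bar> \<le> M" and P0c: "c \<le> koranyi_quartic (x, y, z)" for x y z
  proof -
    define A where "A = x\<^sup>2 + y\<^sup>2"
    define P0 where "P0 = koranyi_quartic (x, y, z)"
    have P0: "P0 = A\<^sup>2 + 16 * z\<^sup>2" "0 < P0" "c \<le> P0" using P0c c by (auto simp: P0_def koranyi_quartic_def A_def)
    \<comment> \<open>The horizontal derivatives of the logarithm of the quartic at the base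
      point.\<close>
    define \<alpha> \<beta> where "\<alpha> = (4 * A * x - 16 * z * y) / P0" and "\<beta> = (4 * A * y + 16 * z * x) / P0"
    \<comment> \<open>This identity is the harmonicity: the gradient part of the second-order term
      contributes trace \<open>3 / 8 * 16 * A / P0\<close>, which cancels against the trace
      \<open>- 6 * A / P0\<close> of the Hessian part.\<close>
    have \<alpha>\<beta>: "\<alpha>\<^sup>2 + \<beta>\<^sup>2 = 16 * A / P0"
    proof -
      have "(4 * A * x - 16 * z * y)\<^sup>2 + (4 * A * y + 16 * z * x)\<^sup>2 = 16 * A * P0"
        unfolding P0(1) A_def by (simp add: power2_eq_square algebra_simps)
      then show ?thesis using P0(2)
        by (simp add: \<alpha>_def \<beta>_def power_divide power2_eq_square flip: add_divide_distrib)
    qed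
    define j3 where "j3 = 3 * \<alpha>\<^sup>2 / 8 - 3 * A / P0"
    have j3: "- j3 = 3 * \<beta>\<^sup>2 / 8 - 3 * A / P0" using \<alpha>\<beta> by (simp add: j3_def)
    have "(1 + l * (- \<alpha> / 2 * a + - \<beta> / 2 * b) + l\<^sup>2 * (j3 * a\<^sup>2 + 3 * \<alpha> * \<beta> / 4 * (a * b) - j3 * b\<^sup>2) - K * l ^ 3) / sqrt P0
        \<le> 1 / sqrt (koranyi_quartic ((x, y, z) \<star> (l * a, l * b, 0)))"
      if l: "0 \<le> l" "l \<le> 1" and ab: "(a, b) \<in> disc"
        and pos: "0 < koranyi_quartic ((x, y, z) \<star> (l * a, l * b, 0))" for l a b
    proof -
      define s d n where "s = x * a + y * b" and "d = x * b - y * a" and "n = a\<^sup>2 + b\<^sup>2"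
      define P1 where "P1 = koranyi_quartic ((x, y, z) \<star> (l * a, l * b, 0))"
      define h1 h2 h3 h4 where "h1 = (4 * A * s + 16 * z * d) / P0" and "h2 = 6 * A * n / P0"
        and "h3 = 4 * s * n / P0" and "h4 = n\<^sup>2 / P0"
      \<comment> \<open>The relative increment, so that \<open>P1 = P0 * (1 + h)\<close>; it is an
        exact polynomial of degree four in \<open>l\<close>.\<close>
      define h where "h = l * h1 + l\<^sup>2 * h2 + l ^ 3 * h3 + l ^ 4 * h4"
      have "P0 * h = l * (4 * A * s + 16 * z * d) + l\<^sup>2 * (6 * A * n) + l ^ 3 * (4 * s * n) + l ^ 4 * n\<^sup>2"
      proof -
        have "P0 * h1 = 4 * A * s + 16 * z * d" "P0 * h2 = 6 * A * n" "P0 * h3 = 4 * s * n" "P0 * h4 = n\<^sup>2"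
          using P0(2) by (simp_all add: h1_def h2_def h3_def h4_def)
        moreover have "P0 * h = l * (P0 * h1) + l\<^sup>2 * (P0 * h2) + l ^ 3 * (P0 * h3) + l ^ 4 * (P0 * h4)"
          by (simp add: h_def algebra_simps)
        ultimately show ?thesis by simp
      qed
      also have "\<dots> = P1 - P0"
      proof -
        \<comment> \<open>Lagrange's identity for the inner product \<open>s\<close> and the
          determinant \<open>d\<close>; it turns the second-order coefficient into
          \<open>6 * A * n\<close>.\<close>
        have "4 * s\<^sup>2 + 4 * d\<^sup>2 = 4 * A * n"
          by (simp add: s_def d_def n_def A_def power2_eq_square algebra_simps)
        moreover have "P1 = (A + 2 * l * s + l\<^sup>2 * n)\<^sup>2 + 16 * (z + l * d / 2)\<^sup>2"
        proof -
          have "(x + l * a)\<^sup>2 + (y + l * b)\<^sup>2 = A + 2 * l * s + l\<^sup>2 * n"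
            by (simp add: A_def s_def n_def power2_eq_square algebra_simps)
          moreover have "x * (l * b) - y * (l * a) = l * d"
            by (simp add: d_def algebra_simps)
          ultimately show ?thesis by (simp only: P1_def koranyi_quartic_def heis_mult.simps fst_conv snd_conv add_0_right)
        qed
        moreover have "(A + 2 * l * s + l\<^sup>2 * n)\<^sup>2 + 16 * (z + l * d / 2)\<^sup>2
            = A\<^sup>2 + 16 * z\<^sup>2 + l * (4 * A * s + 16 * z * d) + l\<^sup>2 * (2 * A * n + (4 * s\<^sup>2 + 4 * d\<^sup>2))
              + l ^ 3 * (4 * s * n) + l ^ 4 * n\<^sup>2"
          by (simp add: power2_eq_square power3_eq_cube power4_eq_xxxx field_simps)
        ultimately show ?thesis by (simp add: P0(1) algebra_simps)
      qed
      finally have P1: "P1 = P0 * (1 + h)" by (simp add: algebra_simps)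
      have h: "- 1 < h" using pos P0(2) unfolding P1_def[symmetric] P1 by (simp add: zero_less_mult_iff)
      have bounds: "\<bar>h1\<bar> \<le> B" "\<bar>h2\<bar> \<le> B" "\<bar>h3\<bar> \<le> B" "\<bar>h4\<bar> \<le> B"
      proof -
        have a: "\<bar>a\<bar> \<le> 1" "\<bar>b\<bar> \<le> 1" using disc_bounds[OF ab] by auto
        have M0: "0 \<le> M" using M by simp
        have xa: "\<bar>x * a\<bar> \<le> M * 1" "\<bar>y * b\<bar> \<le> M * 1" "\<bar>x * b\<bar> \<le> M * 1" "\<bar>y * a\<bar> \<le> M * 1"
          unfolding abs_mult using xyz a M0 by (intro mult_mono; simp)+
        have sd: "\<bar>s\<bar> \<le> 2 * M" "\<bar>d\<bar> \<le> 2 * M" using xa by (auto simp: s_def d_def)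
        have n: "0 \<le> n" "n \<le> 1"
        proof -
          have "norm (a, b) < 1" by (rule disc_norm[OF ab])
          then show "n \<le> 1" unfolding n_def by (simp add: norm_Pair)
        qed (simp add: n_def)
        have A: "0 \<le> A" "A \<le> 2 * M\<^sup>2"
        proof -
          have "x\<^sup>2 \<le> M\<^sup>2" "y\<^sup>2 \<le> M\<^sup>2" using xyz M0 by (simp_all add: abs_le_square_iff[symmetric])
          then show "A \<le> 2 * M\<^sup>2" by (simp add: A_def)
        qed (simp add: A_def)
        have "\<bar>A * s\<bar> \<le> 2 * M\<^sup>2 * (2 * M)" unfolding abs_mult using A sd M0 by (intro mult_mono) auto
        moreover have "\<bar>z * d\<bar> \<le> M * (2 * M)" unfolding abs_mult using xyz sd M0 by (intro mult_mono) auto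
        ultimately have 1: "\<bar>4 * A * s + 16 * z * d\<bar> \<le> 16 * M ^ 3 + 32 * M\<^sup>2"
          by (simp add: power2_eq_square power3_eq_cube)
        have "\<bar>A * n\<bar> \<le> 2 * M\<^sup>2 * 1" unfolding abs_mult using A n by (intro mult_mono) auto
        then have 2: "\<bar>6 * A * n\<bar> \<le> 32 * M\<^sup>2" by simp
        have "\<bar>s * n\<bar> \<le> 2 * M * 1" unfolding abs_mult using sd n M0 by (intro mult_mono) auto
        then have 3: "\<bar>4 * s * n\<bar> \<le> 16 * M" using M0 by simp
        have 4: "\<bar>n\<^sup>2\<bar> \<le> 4" using n power_le_one[of n 2] by simp
        have MM: "0 \<le> M ^ 3" "0 \<le> M\<^sup>2" using M0 by auto
        have div: "\<bar>t / P0\<bar> \<le> B" if "\<bar>t\<bar> \<le> 16 * M ^ 3 + 32 * M\<^sup>2 + 32 * M\<^sup>2 + 16 * M + 4" for t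
          unfolding B_def abs_divide using that P0 c by (intro frac_le) auto
        show "\<bar>h1\<bar> \<le> B" unfolding h1_def using 1 MM M0 by (intro div) linarith
        show "\<bar>h2\<bar> \<le> B" unfolding h2_def using 2 MM M0 by (intro div) linarith
        show "\<bar>h3\<bar> \<le> B" unfolding h3_def using 3 MM M0 by (intro div) linarith
        show "\<bar>h4\<bar> \<le> B" unfolding h4_def using 4 MM M0 by (intro div) linarith
      qed
      have lin: "l * (- h1 / 2) = l * (- \<alpha> / 2 * a + - \<beta> / 2 * b)"
      proof -
        have "h1 = \<alpha> * a + \<beta> * b" unfolding h1_def \<alpha>_def \<beta>_def s_def d_def
          by (simp add: field_simps flip: add_divide_distrib)
        then show ?thesis by (simp add: field_simps)
      qed
      have quad: "3 * h1\<^sup>2 / 8 - h2 / 2 = j3 * a\<^sup>2 + 3 * \<alpha> * \<beta> / 4 * (a * b) - j3 * b\<^sup>2"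
      proof -
        have "h1 = \<alpha> * a + \<beta> * b" unfolding h1_def \<alpha>_def \<beta>_def s_def d_def
          by (simp add: field_simps flip: add_divide_distrib)
        then have "3 * h1\<^sup>2 / 8 - h2 / 2 = (3 * \<alpha>\<^sup>2 / 8 - 3 * A / P0) * a\<^sup>2 + 3 * \<alpha> * \<beta> / 4 * (a * b)
            + (3 * \<beta>\<^sup>2 / 8 - 3 * A / P0) * b\<^sup>2"
          unfolding h2_def n_def by (simp add: power2_eq_square algebra_simps add_divide_distrib)
        then show ?thesis unfolding j3_def[symmetric] j3[symmetric] by simp
      qed
      have "1 + l * (- \<alpha> / 2 * a + - \<beta> / 2 * b) + l\<^sup>2 * (j3 * a\<^sup>2 + 3 * \<alpha> * \<beta> / 4 * (a * b) - j3 * b\<^sup>2) - K * l ^ 3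
          \<le> 1 - h / 2 + 3 * h\<^sup>2 / 8 - 5 * h ^ 3 / 16"
        using cubic_remainder[OF l bounds, folded h_def K_def] unfolding lin quad by linarith
      also have "\<dots> \<le> 1 / sqrt (1 + h)" by (rule inverse_sqrt_ge_cubic[OF h])
      finally have "(1 + l * (- \<alpha> / 2 * a + - \<beta> / 2 * b)
          + l\<^sup>2 * (j3 * a\<^sup>2 + 3 * \<alpha> * \<beta> / 4 * (a * b) - j3 * b\<^sup>2) - K * l ^ 3) / sqrt P0
          \<le> 1 / sqrt (1 + h) / sqrt P0"
        using P0(2) by (intro divide_right_mono) auto
      also have "\<dots> = 1 / sqrt P1" by (simp add: P1 real_sqrt_mult)
      finally show ?thesis unfolding P1_def .
    qed
    then show ?thesis unfolding P0_def by blast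
  qed
  ultimately show thesis by (rule that)
qed

subsection \<open>Barriers\<close>

lemma heis_mult_assoc: "(p \<star> q) \<star> r = p \<star> (q \<star> r)" for p q r :: heis
  by (cases p; cases q; cases r) (simp add: field_simps)

lemma sqrt_koranyi_quartic: "sqrt (koranyi_quartic u) = (koranyi_gauge u)\<^sup>2"
proof -
  obtain x y z where u: "u = (x, y, z)" by (cases u)
  have "koranyi_quartic u = ((koranyi_gauge u)\<^sup>2)\<^sup>2"
    unfolding u using koranyi_gauge_power4[of x y z]
    by (simp add: koranyi_quartic_def del: koranyi_gauge.simps)
  then show ?thesis by (simp only: real_sqrt_abs) simp
qed

lemma koranyi_quartic_eq_power4: "koranyi_quartic u = koranyi_gauge u ^ 4"
  by (cases u) (simp add: koranyi_quartic_def koranyi_gauge_power4 del: koranyi_gauge.simps)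

text \<open>Left translation is continuous, so it maps the compact closure of \<open>D\<close> to a
  bounded set. This bounds the coordinates relative to a pole.\<close>

lemma bounded_heis_translate:
  assumes "bounded D"
  obtains M where "1 \<le> M" "\<And>q x y z. q \<in> D \<Longrightarrow> p \<star> q = (x, y, z) \<Longrightarrow> \<bar>x\<bar> \<le> M \<and> \<bar>y\<bar> \<le> M \<and> \<bar>z\<bar> \<le> M"
proof -
  have "compact ((\<lambda>q. p \<star> q) ` closure D)"
    using assms by (intro compact_continuous_image continuous_intros) (simp add: compact_closure)
  then obtain M where M: "\<And>u. u \<in> (\<lambda>q. p \<star> q) ` closure D \<Longrightarrow> norm u \<le> M"
    using compact_imp_bounded bounded_iff by metis
  show thesis
  proof (rule that[of "max 1 M"])
    fix q x y z assume "q \<in> D" and eq: "p \<star> q = (x, y, z)"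
    then have n: "norm (x, y, z) \<le> M" using closure_subset M by (metis image_eqI subsetD)
    have "\<bar>x\<bar> \<le> norm (x, y, z)" "norm (y, z) \<le> norm (x, y, z)" "\<bar>y\<bar> \<le> norm (y, z)" "\<bar>z\<bar> \<le> norm (y, z)"
      using norm_fst_le[of x "(y, z)"] norm_snd_le[of "(y, z)" x] norm_fst_le[of y z] norm_snd_le[of z y]
      by simp_all
    with n show "\<bar>x\<bar> \<le> max 1 M \<and> \<bar>y\<bar> \<le> max 1 M \<and> \<bar>z\<bar> \<le> max 1 M" by linarith
  qed simp
qed

text \<open>The fundamental solution with pole \<open>p\<close>, made strictly subharmonic by the second term.\<close>
definition koranyi_barrier :: "heis \<Rightarrow> real \<Rightarrow> heis \<Rightarrow> real" where
  "koranyi_barrier p \<kappa> q = (let u = heis_inv p \<star> q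
    in 1 / sqrt (koranyi_quartic u) + \<kappa> * ((fst u)\<^sup>2 + (fst (snd u))\<^sup>2))"

lemma borel_measurable_koranyi_barrier: "koranyi_barrier p \<kappa> \<in> borel_measurable borel"
proof -
  have "(\<lambda>q. sqrt (koranyi_quartic (heis_inv p \<star> q))) \<in> borel_measurable borel"
    "(\<lambda>q. (fst (heis_inv p \<star> q))\<^sup>2 + (fst (snd (heis_inv p \<star> q)))\<^sup>2) \<in> borel_measurable borel"
    unfolding koranyi_quartic_def by (intro borel_measurable_continuous_onI continuous_intros)+
  then show ?thesis
    unfolding koranyi_barrier_def[abs_def] Let_def
    by (intro borel_measurable_add[OF borel_measurable_divide borel_measurable_times] borel_measurable_const)
qed

text \<open>In mean the fundamental solution drops by at most \<open>f * K * l ^ 3\<close>, by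
  \<open>koranyi_expansion\<close>, while the quadratic term gains
  \<open>2 * \<kappa> * l\<^sup>2 * disc_moment\<close>. For small steps the gain prevails.\<close>

lemma walk_mean_koranyi_barrier:
  assumes D: "open D" "bounded D" "frontier D \<noteq> {}" and c: "0 < c" and \<kappa>: "0 < \<kappa>"
    and far: "\<And>q. q \<in> D \<Longrightarrow> c \<le> koranyi_quartic (heis_inv p \<star> q)"
  obtains \<epsilon>\<^sub>0 where "0 < \<epsilon>\<^sub>0"
    "\<And>\<epsilon> \<Lambda> q. 0 < \<epsilon> \<Longrightarrow> \<epsilon> < \<epsilon>\<^sub>0 \<Longrightarrow> (\<And>q. q \<in> D \<Longrightarrow> koranyi_barrier p \<kappa> q \<le> \<Lambda>) \<Longrightarrow> q \<in> D \<Longrightarrow>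
      walk_mean D \<epsilon> (\<lambda>q. ennreal (\<Lambda> - koranyi_barrier p \<kappa> q)) q \<le> ennreal (\<Lambda> - koranyi_barrier p \<kappa> q)"
proof -
  obtain M where M: "1 \<le> M"
    and bdd: "\<And>q x y z. q \<in> D \<Longrightarrow> heis_inv p \<star> q = (x, y, z) \<Longrightarrow> \<bar>x\<bar> \<le> M \<and> \<bar>y\<bar> \<le> M \<and> \<bar>z\<bar> \<le> M"
    using bounded_heis_translate[OF D(2), of "heis_inv p"] by metis
  obtain K where K: "0 < K"
    and exp: "\<And>x y z. \<bar>x\<bar> \<le> M \<Longrightarrow> \<bar>y\<bar> \<le> M \<Longrightarrow> \<bar>z\<bar> \<le> M \<Longrightarrow> c \<le> koranyi_quartic (x, y, z) \<Longrightarrow>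
      \<exists>j1 j2 j3 j4. \<forall>l a b. 0 \<le> l \<longrightarrow> l \<le> 1 \<longrightarrow> (a, b) \<in> disc \<longrightarrow>
        0 < koranyi_quartic ((x, y, z) \<star> (l * a, l * b, 0)) \<longrightarrow>
        (1 + l * (j1 * a + j2 * b) + l\<^sup>2 * (j3 * a\<^sup>2 + j4 * (a * b) - j3 * b\<^sup>2) - K * l ^ 3)
          / sqrt (koranyi_quartic (x, y, z))
        \<le> 1 / sqrt (koranyi_quartic ((x, y, z) \<star> (l * a, l * b, 0)))"
    using koranyi_expansion[OF c M] by metis
  \<comment> \<open>The expansion needs \<open>l \<le> 1\<close>. The other bound makes the cubic
    loss at most the quadratic gain, since \<open>f \<le> 1 / sqrt c\<close>.\<close>
  define \<epsilon>\<^sub>0 where "\<epsilon>\<^sub>0 = min 1 (2 * \<kappa> * disc_moment * sqrt c / K)"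
  have "0 < \<epsilon>\<^sub>0" using K \<kappa> c disc_moment_pos by (simp add: \<epsilon>\<^sub>0_def)
  moreover have "walk_mean D \<epsilon> (\<lambda>q. ennreal (\<Lambda> - koranyi_barrier p \<kappa> q)) q \<le> ennreal (\<Lambda> - koranyi_barrier p \<kappa> q)"
    if \<epsilon>: "0 < \<epsilon>" "\<epsilon> < \<epsilon>\<^sub>0" and \<Lambda>: "\<And>q. q \<in> D \<Longrightarrow> koranyi_barrier p \<kappa> q \<le> \<Lambda>" and q: "q \<in> D" for \<epsilon> \<Lambda> q
  proof -
    obtain x y z where xyz: "heis_inv p \<star> q = (x, y, z)" by (cases "heis_inv p \<star> q")
    define l where "l = walk_radius D \<epsilon> q"
    have l: "0 \<le> l" "l \<le> \<epsilon>" using \<epsilon> by (auto simp: l_def intro: walk_radius_nonneg[OF D(3)] walk_radius_le)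
    have l1: "l \<le> 1" using l \<epsilon> by (simp add: \<epsilon>\<^sub>0_def)
    define P0 where "P0 = koranyi_quartic (x, y, z)"
    have P0: "c \<le> P0" using far[OF q] by (simp add: P0_def xyz)
    define f where "f = 1 / sqrt P0"
    obtain j1 j2 j3 j4 where j: "\<And>a b. (a, b) \<in> disc \<Longrightarrow>
        0 < koranyi_quartic ((x, y, z) \<star> (l * a, l * b, 0)) \<Longrightarrow>
        (1 + l * (j1 * a + j2 * b) + l\<^sup>2 * (j3 * a\<^sup>2 + j4 * (a * b) - j3 * b\<^sup>2) - K * l ^ 3) / sqrt P0
        \<le> 1 / sqrt (koranyi_quartic ((x, y, z) \<star> (l * a, l * b, 0)))"
      using exp[of x y z] bdd[OF q xyz] P0 l(1) l1 unfolding P0_def by blast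
    have "walk_mean D \<epsilon> (\<lambda>q. ennreal (\<Lambda> - koranyi_barrier p \<kappa> q)) q
      \<le> ennreal ((\<Lambda> - f * (1 - K * l ^ 3) - \<kappa> * (x\<^sup>2 + y\<^sup>2))
          + ((- f * l\<^sup>2 * j3 - \<kappa> * l\<^sup>2) + (f * l\<^sup>2 * j3 - \<kappa> * l\<^sup>2)) * disc_moment)"
    \<comment> \<open>In the trace the contributions of \<open>j3\<close> cancel and only the terms
      with \<kappa> are left.\<close>
    proof (rule walk_mean_le_quadratic(1)[OF D(1,3) less_imp_le[OF \<epsilon>(1)] q,
          where ?k1.0 = "- f * l * j1 - 2 * \<kappa> * l * x" and ?k2.0 = "- f * l * j2 - 2 * \<kappa> * l * y"
            and ?k4.0 = "- f * l\<^sup>2 * j4"])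
      show "0 \<le> \<Lambda> - koranyi_barrier p \<kappa> q" if "q \<in> D" for q using \<Lambda>[OF that] by simp
      fix a b assume ab: "(a, b) \<in> disc"
      have u: "heis_inv p \<star> walk_step D \<epsilon> q (a, b) = (x, y, z) \<star> (l * a, l * b, 0)"
        unfolding xyz[symmetric] heis_mult_assoc by (simp add: walk_step_def l_def)
      \<comment> \<open>The new position is again in \<open>D\<close>, hence away from the pole;
        this supplies the positivity that the expansion demands.\<close>
      have "c \<le> koranyi_quartic ((x, y, z) \<star> (l * a, l * b, 0))"
        unfolding u[symmetric] using \<epsilon> by (intro far walk_step_in[OF D(1,3) _ q ab]) simp
      then have "0 < koranyi_quartic ((x, y, z) \<star> (l * a, l * b, 0))" using c by linarith
      from j[OF ab this]
      have "f * (1 + l * (j1 * a + j2 * b) + l\<^sup>2 * (j3 * a\<^sup>2 + j4 * (a * b) - j3 * b\<^sup>2) - K * l ^ 3)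
          \<le> 1 / sqrt (koranyi_quartic ((x, y, z) \<star> (l * a, l * b, 0)))"
        by (simp add: f_def)
      moreover have "koranyi_barrier p \<kappa> (walk_step D \<epsilon> q (a, b))
          = 1 / sqrt (koranyi_quartic ((x, y, z) \<star> (l * a, l * b, 0))) + \<kappa> * ((x + l * a)\<^sup>2 + (y + l * b)\<^sup>2)"
        unfolding koranyi_barrier_def Let_def u by simp
      ultimately have "\<Lambda> - koranyi_barrier p \<kappa> (walk_step D \<epsilon> q (a, b)) \<le> \<Lambda>
          - f * (1 + l * (j1 * a + j2 * b) + l\<^sup>2 * (j3 * a\<^sup>2 + j4 * (a * b) - j3 * b\<^sup>2) - K * l ^ 3)
          - \<kappa> * ((x + l * a)\<^sup>2 + (y + l * b)\<^sup>2)" by linarith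
      also have "\<dots> = (\<Lambda> - f * (1 - K * l ^ 3) - \<kappa> * (x\<^sup>2 + y\<^sup>2))
          + (- f * l * j1 - 2 * \<kappa> * l * x) * a + (- f * l * j2 - 2 * \<kappa> * l * y) * b
          + (- f * l\<^sup>2 * j3 - \<kappa> * l\<^sup>2) * a\<^sup>2 + (- f * l\<^sup>2 * j4) * (a * b) + (f * l\<^sup>2 * j3 - \<kappa> * l\<^sup>2) * b\<^sup>2"
        by (simp add: power2_sum power_mult_distrib algebra_simps)
      finally show "\<Lambda> - koranyi_barrier p \<kappa> (walk_step D \<epsilon> q (a, b)) \<le> \<dots>" .
    qed
    also have "\<dots> \<le> ennreal (\<Lambda> - koranyi_barrier p \<kappa> q)"
    proof (rule ennreal_leI)
      have "f \<le> 1 / sqrt c" unfolding f_def using P0 c by (intro divide_left_mono) auto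
      moreover have "l * K \<le> 2 * \<kappa> * disc_moment * sqrt c"
      proof -
        have "l \<le> 2 * \<kappa> * disc_moment * sqrt c / K" using l \<epsilon> by (simp add: \<epsilon>\<^sub>0_def)
        then show ?thesis using K by (simp add: pos_le_divide_eq)
      qed
      ultimately have "f * (l * K) \<le> 1 / sqrt c * (2 * \<kappa> * disc_moment * sqrt c)"
        by (rule mult_mono) (use l K c in simp_all)
      then have "l\<^sup>2 * (f * (l * K)) \<le> l\<^sup>2 * (2 * \<kappa> * disc_moment)"
        using c by (intro mult_left_mono) auto
      then have "f * K * l ^ 3 \<le> 2 * (\<kappa> * l\<^sup>2 * disc_moment)"
        by (simp add: power2_eq_square power3_eq_cube mult_ac)
      moreover have "koranyi_barrier p \<kappa> q = f + \<kappa> * (x\<^sup>2 + y\<^sup>2)"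
        by (simp add: koranyi_barrier_def xyz f_def P0_def)
      ultimately show "(\<Lambda> - f * (1 - K * l ^ 3) - \<kappa> * (x\<^sup>2 + y\<^sup>2))
          + ((- f * l\<^sup>2 * j3 - \<kappa> * l\<^sup>2) + (f * l\<^sup>2 * j3 - \<kappa> * l\<^sup>2)) * disc_moment \<le> \<Lambda> - koranyi_barrier p \<kappa> q"
        by (simp add: algebra_simps)
    qed
    finally show ?thesis .
  qed
  ultimately show thesis by (rule that)
qed

lemma one_less_inverse_square:
  fixes \<mu> :: real
  assumes "0 < \<mu>" "\<mu> < 1"
  shows "1 < 1 / \<mu>\<^sup>2"
proof -
  have "\<mu>\<^sup>2 < 1" using assms by (simp add: abs_square_less_1)
  moreover have "0 < \<mu>\<^sup>2" using assms by simp
  ultimately show ?thesis by (simp only: pos_less_divide_eq mult_1_left)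
qed

text \<open>Take the corkscrew centre as pole and normalise an upper bound minus the barrier. All
  estimates are proportional to \<open>t = 1 / r\<^sup>2\<close>, so \<theta> depends on \<mu>
  alone.\<close>

lemma corkscrew_barrier:
  assumes D: "open D" "bounded D" "frontier D \<noteq> {}" and \<mu>: "0 < \<mu>" "\<mu> < 1" and r: "0 < r"
    and ball: "heis_ball p (\<mu> * r) \<subseteq> heis_ball q\<^sub>0 r - D"
  defines "\<theta> \<equiv> (1 / \<mu>\<^sup>2 - 3 / 16) / (1 / \<mu>\<^sup>2 - 1 / 16)"
  obtains \<epsilon>\<^sub>0 u where "0 < \<epsilon>\<^sub>0" "u \<in> borel_measurable borel"
    "\<And>\<epsilon> q. 0 < \<epsilon> \<Longrightarrow> \<epsilon> < \<epsilon>\<^sub>0 \<Longrightarrow> q \<in> D \<Longrightarrow> walk_mean D \<epsilon> u q \<le> u q"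
    "\<And>q. q \<in> D \<Longrightarrow> 5 * r \<le> heis_dist q\<^sub>0 q \<Longrightarrow> 1 \<le> u q"
    "\<And>q. q \<in> D \<Longrightarrow> heis_dist q\<^sub>0 q \<le> r \<Longrightarrow> u q \<le> ennreal \<theta>"
proof -
  define t where "t = 1 / r\<^sup>2"
  define m where "m = 1 / \<mu>\<^sup>2"
  have t: "0 < t" using r by (simp add: t_def)
  have m: "1 < m" unfolding m_def by (rule one_less_inverse_square[OF \<mu>])
  \<comment> \<open>At distance \<open>5 * r\<close> from \<open>q\<^sub>0\<close> the pole is at
    least \<open>4 * r\<close> away and the barrier is at most \<open>t / 16 + t / 16\<close>; thus
    \<open>N\<close> is a lower bound there for \<Lambda> minus the barrier.\<close>
  define N where "N = m * t - t / 16"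
  have "1 * t < m * t" using m t by (rule mult_strict_right_mono)
  then have N: "0 < N" using t unfolding N_def by linarith
  \<comment> \<open>On \<open>D\<close> the distance to the pole is at least
    \<open>\<mu> * r\<close>, so the fundamental solution is at most \<open>m * t\<close>; the extra
    \<open>t / 16\<close> covers the quadratic term.\<close>
  define \<Lambda> where "\<Lambda> = m * t + t / 16"
  have p: "heis_dist q\<^sub>0 p < r"
  proof -
    have "p \<in> heis_ball p (\<mu> * r)" using \<mu> r by (simp add: heis_ball_def)
    then have "p \<in> heis_ball q\<^sub>0 r" using ball by blast
    then show ?thesis by (simp add: heis_ball_def)
  qed
  have far: "\<mu> * r \<le> heis_dist p q" if "q \<in> D" for q
  proof -
    have "q \<notin> heis_ball p (\<mu> * r)" using ball that by blast
    then show ?thesis by (simp add: heis_ball_def)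
  qed
  obtain M where M: "1 \<le> M"
    and bdd: "\<And>q x y z. q \<in> D \<Longrightarrow> heis_inv p \<star> q = (x, y, z) \<Longrightarrow> \<bar>x\<bar> \<le> M \<and> \<bar>y\<bar> \<le> M \<and> \<bar>z\<bar> \<le> M"
    using bounded_heis_translate[OF D(2), of "heis_inv p"] by metis
  \<comment> \<open>Makes the quadratic term at most \<open>t / 16\<close> on \<open>D\<close>,
    where the squared horizontal length is at most \<open>2 * M\<^sup>2\<close>.\<close>
  define \<kappa> where "\<kappa> = t / (32 * M\<^sup>2)"
  have \<kappa>: "0 < \<kappa>" using t M by (simp add: \<kappa>_def)
  define F where "F q = 1 / (heis_dist p q)\<^sup>2" for q
  have barrier: "F q \<le> koranyi_barrier p \<kappa> q" "koranyi_barrier p \<kappa> q \<le> F q + t / 16" if q: "q \<in> D" for q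
  proof -
    obtain x y z where xyz: "heis_inv p \<star> q = (x, y, z)" by (cases "heis_inv p \<star> q")
    have eq: "koranyi_barrier p \<kappa> q = F q + \<kappa> * (x\<^sup>2 + y\<^sup>2)"
      by (simp add: koranyi_barrier_def F_def heis_dist_def sqrt_koranyi_quartic xyz)
    have "x\<^sup>2 \<le> M\<^sup>2" "y\<^sup>2 \<le> M\<^sup>2" using bdd[OF q xyz] M by (simp_all add: abs_le_square_iff[symmetric])
    then have "\<kappa> * (x\<^sup>2 + y\<^sup>2) \<le> \<kappa> * (2 * M\<^sup>2)" using \<kappa> by (intro mult_left_mono) auto
    also have "\<dots> = t / 16" using M by (simp add: \<kappa>_def)
    finally show "koranyi_barrier p \<kappa> q \<le> F q + t / 16" by (simp add: eq)
    show "F q \<le> koranyi_barrier p \<kappa> q" using \<kappa> by (simp add: eq)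
  qed
  have F_le: "F q \<le> 1 / s\<^sup>2" if "0 < s" "s \<le> heis_dist p q" for s q
    unfolding F_def using that by (intro divide_left_mono mult_pos_pos power_mono) auto
  have F: "F q \<le> m * t" if "q \<in> D" for q
    using F_le[OF _ far[OF that]] \<mu> r by (simp add: m_def t_def power_mult_distrib)
  have le: "koranyi_barrier p \<kappa> q \<le> \<Lambda>" if "q \<in> D" for q
    using barrier(2)[OF that] F[OF that] by (simp add: \<Lambda>_def)
  have c: "0 < (\<mu> * r) ^ 4" using \<mu> r by simp
  have "(\<mu> * r) ^ 4 \<le> koranyi_quartic (heis_inv p \<star> q)" if "q \<in> D" for q
    using far[OF that] \<mu> r unfolding koranyi_quartic_eq_power4 heis_dist_def by (intro power_mono) auto
  from walk_mean_koranyi_barrier[OF D c \<kappa> this] obtain \<epsilon>\<^sub>0 where \<epsilon>\<^sub>0: "0 < \<epsilon>\<^sub>0"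
    and super: "\<And>\<epsilon> q. 0 < \<epsilon> \<Longrightarrow> \<epsilon> < \<epsilon>\<^sub>0 \<Longrightarrow> q \<in> D \<Longrightarrow>
      walk_mean D \<epsilon> (\<lambda>q. ennreal (\<Lambda> - koranyi_barrier p \<kappa> q)) q \<le> ennreal (\<Lambda> - koranyi_barrier p \<kappa> q)"
    using le by metis
  define u where "u q = ennreal (1 / N) * ennreal (\<Lambda> - koranyi_barrier p \<kappa> q)" for q
  have u: "u q = ennreal ((\<Lambda> - koranyi_barrier p \<kappa> q) / N)" if "q \<in> D" for q
    unfolding u_def using N le[OF that] by (simp flip: ennreal_mult)
  have meas: "(\<lambda>q. ennreal (\<Lambda> - koranyi_barrier p \<kappa> q)) \<in> borel_measurable borel"
    by (intro measurable_compose[OF _ measurable_ennreal] borel_measurable_diff borel_measurable_const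
        borel_measurable_koranyi_barrier)
  show thesis
  proof (rule that[OF \<epsilon>\<^sub>0, of u])
    show "u \<in> borel_measurable borel"
      unfolding u_def by (intro borel_measurable_times_ennreal borel_measurable_const meas)
    fix q assume q: "q \<in> D"
    show "walk_mean D \<epsilon> u q \<le> u q" if "0 < \<epsilon>" "\<epsilon> < \<epsilon>\<^sub>0" for \<epsilon>
    proof -
      have "walk_mean D \<epsilon> u q = ennreal (1 / N) * walk_mean D \<epsilon> (\<lambda>q. ennreal (\<Lambda> - koranyi_barrier p \<kappa> q)) q"
        unfolding walk_mean_def u_def
        by (intro nn_integral_cmult measurable_compose[OF _ meas] measurable_walk_step) simp_all
      also have "\<dots> \<le> u q" unfolding u_def by (intro mult_left_mono super that q) simp
      finally show ?thesis .
    qed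
    show "1 \<le> u q" if "5 * r \<le> heis_dist q\<^sub>0 q"
    proof -
      have "4 * r \<le> heis_dist p q" using that p heis_dist_triangle[of q\<^sub>0 q p] by linarith
      then have "F q \<le> t / 16" using F_le[of "4 * r" q] r by (simp add: t_def power_mult_distrib)
      then have "N \<le> \<Lambda> - koranyi_barrier p \<kappa> q" using barrier(2)[OF q] by (simp add: N_def \<Lambda>_def)
      then have "1 \<le> (\<Lambda> - koranyi_barrier p \<kappa> q) / N" using N by simp
      then show ?thesis unfolding u[OF q] using ennreal_leI by fastforce
    qed
    show "u q \<le> ennreal \<theta>" if "heis_dist q\<^sub>0 q \<le> r"
    proof -
      \<comment> \<open>Near \<open>q\<^sub>0\<close> the pole is at distance at most
        \<open>2 * r\<close>, so the fundamental solution is at least \<open>t / 4\<close>; this is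
        the source of the numerator of \<theta>.\<close>
      have d: "heis_dist p q \<le> 2 * r" "0 < heis_dist p q"
        using that p heis_dist_triangle[of p q q\<^sub>0] far[OF q] mult_pos_pos[OF \<mu>(1) r]
        by (simp_all add: heis_dist_commute[of p q\<^sub>0])
      then have "1 / (2 * r)\<^sup>2 \<le> F q"
        unfolding F_def using r by (intro divide_left_mono mult_pos_pos power_mono) auto
      then have "t / 4 \<le> F q" by (simp add: t_def power_mult_distrib)
      then have "\<Lambda> - koranyi_barrier p \<kappa> q \<le> (m - 3 / 16) * t"
        using barrier(1)[OF q] by (simp add: \<Lambda>_def algebra_simps)
      then have "(\<Lambda> - koranyi_barrier p \<kappa> q) / N \<le> (m - 3 / 16) * t / N"
        using N by (intro divide_right_mono) auto
      also have "\<dots> = (m - 3 / 16) * t / ((m - 1 / 16) * t)" by (simp add: N_def left_diff_distrib)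
      also have "\<dots> = \<theta>" using t by (simp add: \<theta>_def m_def)
      finally show ?thesis unfolding u[OF q] by (rule ennreal_leI)
    qed
  qed
qed

text \<open>Through \<open>walk_hitting\<close>, such a function bounds by \<open>c\<close> the
  probability that the walk from a point of \<open>D\<close> within \<rho> of
  \<open>q\<^sub>0\<close> ever reaches distance \<delta>.\<close>

definition walk_barrier ::
  "heis set \<Rightarrow> real \<Rightarrow> heis \<Rightarrow> real \<Rightarrow> real \<Rightarrow> ennreal \<Rightarrow> (heis \<Rightarrow> ennreal) \<Rightarrow> bool" where
  "walk_barrier D \<epsilon> q\<^sub>0 \<delta> \<rho> c U \<longleftrightarrow> U \<in> borel_measurable borel
    \<and> (\<forall>q\<in>D. walk_mean D \<epsilon> U q \<le> U q)
    \<and> (\<forall>q\<in>D. \<delta> \<le> heis_dist q\<^sub>0 q \<longrightarrow> 1 \<le> U q)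
    \<and> (\<forall>q\<in>D. heis_dist q\<^sub>0 q < \<rho> \<longrightarrow> U q \<le> c)"

lemma walk_barrierD:
  assumes "walk_barrier D \<epsilon> q\<^sub>0 \<delta> \<rho> c U"
  shows "U \<in> borel_measurable borel" "q \<in> D \<Longrightarrow> walk_mean D \<epsilon> U q \<le> U q"
    "q \<in> D \<Longrightarrow> \<delta> \<le> heis_dist q\<^sub>0 q \<Longrightarrow> 1 \<le> U q"
    "q \<in> D \<Longrightarrow> heis_dist q\<^sub>0 q < \<rho> \<Longrightarrow> U q \<le> c"
  using assms unfolding walk_barrier_def by blast+

text \<open>At scale \<open>\<rho>\<close> the barriers are glued by a minimum: next to the sphere of radius \<open>\<rho>\<close> the new one
  exceeds the old one, so the minimum is taken by the old one there.\<close>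
lemma iterated_barrier:
  assumes D: "open D" "bounded D" "frontier D \<noteq> {}" and \<mu>: "0 < \<mu>" "\<mu> < 1" and r\<^sub>0: "0 < r\<^sub>0"
    and corkscrew: "\<And>r. 0 < r \<Longrightarrow> r < r\<^sub>0 \<Longrightarrow> \<exists>p. heis_ball p (\<mu> * r) \<subseteq> heis_ball q\<^sub>0 r - D"
    and \<delta>: "0 < \<delta>"
  defines "\<theta> \<equiv> (1 / \<mu>\<^sup>2 - 3 / 16) / (1 / \<mu>\<^sup>2 - 1 / 16)"
  shows "\<exists>\<rho> \<epsilon>\<^sub>0. 0 < \<rho> \<and> \<rho> \<le> \<delta> \<and> 0 < \<epsilon>\<^sub>0 \<and>
    (\<forall>\<epsilon>. 0 < \<epsilon> \<longrightarrow> \<epsilon> < \<epsilon>\<^sub>0 \<longrightarrow> (\<exists>U. walk_barrier D \<epsilon> q\<^sub>0 \<delta> \<rho> (ennreal \<theta> ^ k) U))"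
proof (induction k)
  case 0
  have "walk_barrier D \<epsilon> q\<^sub>0 \<delta> \<delta> (ennreal \<theta> ^ 0) (\<lambda>_. 1)" for \<epsilon>
    by (simp add: walk_barrier_def walk_mean_def disc.emeasure_space_1)
  then show ?case using \<delta> zero_less_one by blast
next
  case (Suc k)
  obtain \<rho> \<epsilon>1 where \<rho>: "0 < \<rho>" "\<rho> \<le> \<delta>" and \<epsilon>1: "0 < \<epsilon>1" and old: "\<And>\<epsilon>. 0 < \<epsilon> \<Longrightarrow> \<epsilon> < \<epsilon>1 \<Longrightarrow>
      \<exists>U. walk_barrier D \<epsilon> q\<^sub>0 \<delta> \<rho> (ennreal \<theta> ^ k) U"
    using Suc.IH by blast
  \<comment> \<open>Below \<open>r\<^sub>0\<close> the corkscrew condition applies, and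
    \<open>10 * r \<le> \<rho>\<close> puts the radius \<open>5 * r\<close>, beyond which the new
    barrier is at least one, inside half the old scale.\<close>
  define r where "r = min (r\<^sub>0 / 2) (\<rho> / 10)"
  have r: "0 < r" "r < r\<^sub>0" "10 * r \<le> \<rho>" using \<rho> r\<^sub>0 by (auto simp: r_def)
  from corkscrew[OF r(1,2)] obtain p where ball: "heis_ball p (\<mu> * r) \<subseteq> heis_ball q\<^sub>0 r - D" by blast
  obtain \<epsilon>2 u where \<epsilon>2: "0 < \<epsilon>2" and u_meas: "u \<in> borel_measurable borel"
    and u_super: "\<And>\<epsilon> q. 0 < \<epsilon> \<Longrightarrow> \<epsilon> < \<epsilon>2 \<Longrightarrow> q \<in> D \<Longrightarrow> walk_mean D \<epsilon> u q \<le> u q"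
    and u_far: "\<And>q. q \<in> D \<Longrightarrow> 5 * r \<le> heis_dist q\<^sub>0 q \<Longrightarrow> 1 \<le> u q"
    and u_near: "\<And>q. q \<in> D \<Longrightarrow> heis_dist q\<^sub>0 q \<le> r \<Longrightarrow> u q \<le> ennreal \<theta>"
    using corkscrew_barrier[OF D \<mu> r(1) ball, folded \<theta>_def] by metis
  \<comment> \<open>The bound \<open>\<rho> / 2\<close> keeps a step from the inner half of the ball
    of radius \<rho> inside that ball.\<close>
  define \<epsilon>\<^sub>0 where "\<epsilon>\<^sub>0 = min (min \<epsilon>1 \<epsilon>2) (\<rho> / 2)"
  have "\<exists>V. walk_barrier D \<epsilon> q\<^sub>0 \<delta> r (ennreal \<theta> ^ Suc k) V" if \<epsilon>: "0 < \<epsilon>" "\<epsilon> < \<epsilon>\<^sub>0" for \<epsilon>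
  proof -
    have \<epsilon>': "\<epsilon> < \<epsilon>1" "\<epsilon> < \<epsilon>2" "\<epsilon> < \<rho> / 2" using \<epsilon> by (auto simp: \<epsilon>\<^sub>0_def)
    from old[OF \<epsilon>(1) \<epsilon>'(1)] obtain U where U: "walk_barrier D \<epsilon> q\<^sub>0 \<delta> \<rho> (ennreal \<theta> ^ k) U" by blast
    note U_meas = walk_barrierD(1)[OF U] and U_super = walk_barrierD(2)[OF U]
      and U_far = walk_barrierD(3)[OF U] and U_near = walk_barrierD(4)[OF U]
    \<comment> \<open>The factor \<open>ennreal \<theta> ^ k\<close> lifts the new barrier to the
      bound that the old one satisfies near \<open>q\<^sub>0\<close>.\<close>
    define V where "V q = (if heis_dist q\<^sub>0 q < \<rho> then min (U q) (ennreal \<theta> ^ k * u q) else U q)" for q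
    have VU: "V q \<le> U q" for q by (simp add: V_def)
    have "{q. heis_dist q\<^sub>0 q < \<rho>} \<in> sets borel"
      using open_heis_ball[of q\<^sub>0 \<rho>] by (simp add: heis_ball_def)
    then have V_meas: "V \<in> borel_measurable borel"
      unfolding V_def[abs_def] using U_meas u_meas by (intro measurable_If) auto
    have "walk_mean D \<epsilon> V q \<le> V q" if q: "q \<in> D" for q
    proof (cases "V q = U q")
      case True
      have "walk_mean D \<epsilon> V q \<le> walk_mean D \<epsilon> U q"
        by (intro walk_mean_mono[OF D(1,3) less_imp_le[OF \<epsilon>(1)] q] VU)
      also have "\<dots> \<le> V q" unfolding True by (rule U_super[OF q])
      finally show ?thesis .
    next
      case False
      then have near: "heis_dist q\<^sub>0 q < \<rho>" and V: "V q = ennreal \<theta> ^ k * u q"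
        and less: "ennreal \<theta> ^ k * u q < U q"
        by (auto simp: V_def min_def split: if_splits)
      \<comment> \<open>Beyond \<open>5 * r\<close> the scaled new barrier would be at least the
        bound on \<open>U\<close>, so it could not be strictly smaller than
        \<open>U\<close>.\<close>
      have "\<not> 5 * r \<le> heis_dist q\<^sub>0 q"
      proof
        assume "5 * r \<le> heis_dist q\<^sub>0 q"
        then have "ennreal \<theta> ^ k * 1 \<le> ennreal \<theta> ^ k * u q" by (intro mult_left_mono u_far[OF q]) auto
        with less U_near[OF q near] show False by simp
      qed
      then have inner: "heis_dist q\<^sub>0 q < \<rho> / 2" using r(3) by linarith
      have "V (walk_step D \<epsilon> q w) \<le> ennreal \<theta> ^ k * u (walk_step D \<epsilon> q w)" if w: "w \<in> disc" for w
      proof -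
        have "heis_dist q\<^sub>0 (walk_step D \<epsilon> q w) < \<rho>"
          using heis_dist_triangle[of q\<^sub>0 "walk_step D \<epsilon> q w" q] inner \<epsilon>'(3)
            walk_step_dist[OF D(3) less_imp_le[OF \<epsilon>(1)] w, of q] by linarith
        then show ?thesis by (simp add: V_def)
      qed
      then have "walk_mean D \<epsilon> V q \<le> (\<integral>\<^sup>+w. ennreal \<theta> ^ k * u (walk_step D \<epsilon> q w) \<partial>disc_measure)"
        unfolding walk_mean_def by (intro nn_integral_mono) (simp add: space_disc_measure)
      also have "\<dots> = ennreal \<theta> ^ k * walk_mean D \<epsilon> u q"
        unfolding walk_mean_def
        by (intro nn_integral_cmult measurable_compose[OF _ u_meas] measurable_walk_step) simp_all
      also have "\<dots> \<le> V q"
        unfolding V by (intro mult_left_mono u_super[OF \<epsilon>(1) \<epsilon>'(2) q]) simp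
      finally show ?thesis .
    qed
    moreover have "1 \<le> V q" if "q \<in> D" "\<delta> \<le> heis_dist q\<^sub>0 q" for q
      using U_far[OF that] that \<rho> by (simp add: V_def)
    moreover have "V q \<le> ennreal \<theta> ^ Suc k" if "q \<in> D" "heis_dist q\<^sub>0 q < r" for q
    proof -
      have "V q \<le> ennreal \<theta> ^ k * u q" using that r \<rho> by (simp add: V_def)
      also have "\<dots> \<le> ennreal \<theta> ^ k * ennreal \<theta>" using that by (intro mult_left_mono u_near) auto
      finally show ?thesis by (simp add: mult.commute)
    qed
    ultimately have "walk_barrier D \<epsilon> q\<^sub>0 \<delta> r (ennreal \<theta> ^ Suc k) V"
      using V_meas unfolding walk_barrier_def by blast
    then show ?thesis by (intro exI[of _ V])
  qed
  moreover have "0 < \<epsilon>\<^sub>0" "r \<le> \<delta>" using \<epsilon>1 \<epsilon>2 \<rho> r by (auto simp: \<epsilon>\<^sub>0_def)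
  ultimately show ?case using r(1) by blast
qed

section \<open>Walk-regularity of corkscrew points\<close>

theorem theorem8p3:
  fixes D :: "heis set" and q\<^sub>0 :: heis
  assumes "open D" and "bounded D" and "connected D"
    and "q\<^sub>0 \<in> frontier D"
    and "exterior_corkscrew D q\<^sub>0"
  shows "walk_regular D q\<^sub>0"
  unfolding walk_regular_def
proof (intro allI impI)
  fix \<eta> \<delta> :: real assume \<eta>: "0 < \<eta>" and \<delta>: "0 < \<delta>"
  have D: "open D" "bounded D" "frontier D \<noteq> {}" using assms by auto
  from assms(5) obtain \<mu> where \<mu>: "0 < \<mu>" "\<mu> < 1"
    and ev: "\<forall>\<^sub>F r in at_right 0. \<exists>p. heis_ball p (\<mu> * r) \<subseteq> heis_ball q\<^sub>0 r - D"
    unfolding exterior_corkscrew_def by blast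
  from ev obtain r\<^sub>0 where r\<^sub>0: "0 < r\<^sub>0"
    and corkscrew: "\<And>r. 0 < r \<Longrightarrow> r < r\<^sub>0 \<Longrightarrow> \<exists>p. heis_ball p (\<mu> * r) \<subseteq> heis_ball q\<^sub>0 r - D"
    unfolding eventually_at_right_field by blast
  define \<theta> where "\<theta> = (1 / \<mu>\<^sup>2 - 3 / 16) / (1 / \<mu>\<^sup>2 - 1 / 16)"
  have "1 < 1 / \<mu>\<^sup>2" by (rule one_less_inverse_square[OF \<mu>])
  then have \<theta>: "0 \<le> \<theta>" "\<theta> < 1" by (simp_all add: \<theta>_def)
  \<comment> \<open>With \<open>k\<close> scales the probability of escaping is at most
    \<open>\<theta> ^ k\<close>, hence below \<eta>.\<close>
  obtain k where k: "\<theta> ^ k < \<eta>" using real_arch_pow_inv[OF \<eta> \<theta>(2)] by blast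
  \<comment> \<open>Passing to the limit of the walk preserves only a weak inequality; staying
    within half the radius makes the final one strict.\<close>
  have \<delta>2: "0 < \<delta> / 2" using \<delta> by simp
  obtain \<rho> \<epsilon>\<^sub>0 where \<rho>: "0 < \<rho>" "\<rho> \<le> \<delta> / 2" and \<epsilon>\<^sub>0: "0 < \<epsilon>\<^sub>0"
    and barrier: "\<And>\<epsilon>. 0 < \<epsilon> \<Longrightarrow> \<epsilon> < \<epsilon>\<^sub>0 \<Longrightarrow> \<exists>U. walk_barrier D \<epsilon> q\<^sub>0 (\<delta> / 2) \<rho> (ennreal \<theta> ^ k) U"
    using iterated_barrier[OF D \<mu> r\<^sub>0 corkscrew \<delta>2, of k, folded \<theta>_def] by blast
  have main: "\<P>(\<omega> in walk_space. walk_limit D \<epsilon> q \<omega> \<in> heis_ball q\<^sub>0 \<delta>) \<ge> 1 - \<eta>"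
    if \<epsilon>: "0 < \<epsilon>" "\<epsilon> < \<epsilon>\<^sub>0" and q: "q \<in> heis_ball q\<^sub>0 \<rho> \<inter> D" for \<epsilon> q
  proof -
    from barrier[OF \<epsilon>] obtain U where "walk_barrier D \<epsilon> q\<^sub>0 (\<delta> / 2) \<rho> (ennreal \<theta> ^ k) U" by blast
    note U = walk_barrierD[OF this]
    define S where "S = {p. \<delta> / 2 \<le> heis_dist q\<^sub>0 p}"
    have S: "S \<in> sets borel"
      unfolding S_def by (intro borel_closed closed_Collect_le continuous_intros)
    define E where "E = {\<omega> \<in> space walk_space. \<exists>n. heis_walk D \<epsilon> q \<omega> n \<in> S}"
    define L where "L = {\<omega> \<in> space walk_space. walk_limit D \<epsilon> q \<omega> \<in> heis_ball q\<^sub>0 \<delta>}"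
    have En: "{\<omega> \<in> space walk_space. heis_walk D \<epsilon> q \<omega> n \<in> S} \<in> sets walk_space" for n
      using measurable_sets[OF measurable_heis_walk S] by (simp add: vimage_def Int_def conj_commute)
    have "E = (\<Union>n. {\<omega> \<in> space walk_space. heis_walk D \<epsilon> q \<omega> n \<in> S})"
      by (auto simp: E_def)
    then have E: "E \<in> sets walk_space" using En by auto
    have lim_meas: "walk_limit D \<epsilon> q \<in> borel_measurable walk_space"
      unfolding walk_limit_def by (intro borel_measurable_lim_metric measurable_heis_walk)
    have L: "L \<in> sets walk_space"
      using measurable_sets[OF lim_meas, of "heis_ball q\<^sub>0 \<delta>"] open_heis_ball[of q\<^sub>0 \<delta>]
      by (simp add: L_def vimage_def Int_def conj_commute)
    have "1 * emeasure walk_space E \<le> U q"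
      unfolding E_def using q U(3)
      by (intro walk_hitting[OF D(1,3) less_imp_le[OF \<epsilon>(1)] U(1,2) S]) (auto simp: S_def)
    also have "\<dots> \<le> ennreal \<theta> ^ k" using q by (intro U(4)) (auto simp: heis_ball_def)
    also have "\<dots> \<le> ennreal \<eta>" using k \<theta> by (simp add: ennreal_power ennreal_leI)
    finally have "measure walk_space E \<le> \<eta>"
      using \<eta> by (simp add: walk_space.emeasure_eq_measure)
    then have "1 - \<eta> \<le> measure walk_space (space walk_space - E)"
      using walk_space.prob_compl[OF E] by simp
    \<comment> \<open>Off the hitting event all positions stay within \<open>\<delta> / 2\<close>,
      and so does the limit wherever it exists, which is almost everywhere.\<close>
    also have "\<dots> \<le> measure walk_space L"
    proof (rule walk_space.finite_measure_mono_AE[OF _ L])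
      have "AE \<omega> in walk_space. convergent (heis_walk D \<epsilon> q \<omega>)"
        using q \<epsilon> by (intro AE_walk_convergent D) auto
      then show "AE \<omega> in walk_space. \<omega> \<in> space walk_space - E \<longrightarrow> \<omega> \<in> L"
      proof (rule AE_mp, intro AE_I2 impI)
        fix \<omega> assume \<omega>: "\<omega> \<in> space walk_space" "convergent (heis_walk D \<epsilon> q \<omega>)" "\<omega> \<in> space walk_space - E"
        have lim: "heis_walk D \<epsilon> q \<omega> \<longlonglongrightarrow> walk_limit D \<epsilon> q \<omega>"
          using \<omega>(2) by (simp add: convergent_LIMSEQ_iff walk_limit_def)
        have "continuous_on UNIV (heis_dist q\<^sub>0)"
          by (intro continuous_on_heis_dist continuous_on_const continuous_on_id)
        then have "\<forall>p\<in>UNIV. isCont (heis_dist q\<^sub>0) p"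
          by (rule continuous_on_eq_continuous_at[OF open_UNIV, THEN iffD1])
        then have "isCont (heis_dist q\<^sub>0) (walk_limit D \<epsilon> q \<omega>)"
          by (rule bspec) (rule UNIV_I)
        then have "(\<lambda>n. heis_dist q\<^sub>0 (heis_walk D \<epsilon> q \<omega> n)) \<longlonglongrightarrow> heis_dist q\<^sub>0 (walk_limit D \<epsilon> q \<omega>)"
          by (rule isCont_tendsto_compose[OF _ lim])
        moreover have "heis_dist q\<^sub>0 (heis_walk D \<epsilon> q \<omega> n) \<le> \<delta> / 2" for n
        proof -
          have "heis_walk D \<epsilon> q \<omega> n \<notin> S" using \<omega>(1,3) unfolding E_def by blast
          then show ?thesis by (simp add: S_def)
        qed
        ultimately have "heis_dist q\<^sub>0 (walk_limit D \<epsilon> q \<omega>) \<le> \<delta> / 2"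
          by (intro LIMSEQ_le_const2) auto
        then show "\<omega> \<in> L" using \<omega>(1) \<delta> by (simp add: L_def heis_ball_def)
      qed
    qed
    finally show ?thesis unfolding L_def .
  qed
  show "\<exists>\<delta>' \<epsilon>'. 0 < \<delta>' \<and> \<delta>' < \<delta> \<and> 0 < \<epsilon>' \<and> \<epsilon>' < 1 \<and>
      (\<forall>\<epsilon> q. 0 < \<epsilon> \<and> \<epsilon> < \<epsilon>' \<and> q \<in> heis_ball q\<^sub>0 \<delta>' \<inter> D \<longrightarrow>
        \<P>(\<omega> in walk_space. walk_limit D \<epsilon> q \<omega> \<in> heis_ball q\<^sub>0 \<delta>) \<ge> 1 - \<eta>)"
    using main \<rho> \<delta> \<epsilon>\<^sub>0 by (intro exI[of _ \<rho>] exI[of _ "min \<epsilon>\<^sub>0 (1 / 2)"]) auto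
qed

end
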